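(* Let $d,D\ge 1$, let $\mathbb G\le\mathbb R^D$ be a closed subgroup of full dimension, and let $\mathcal S\subset\mathbb G$ be finite, symmetric, and generating in the sense that $\overline{\langle\mathcal S\rangle}=\mathbb G$. Let $T$ be an ergodic (probability preserving) $\mathbb Z^d$-action on the standard non-atomic probability space $(X,\mathcal B,m)$. Then there is a bounded, measurable cocycle $F:\mathbb Z^d\times X\to\mathbb G$ with ergodic skew product action $T^{(F)}$ such that $F(e_k,\cdot)\in\mathcal S\cup\{0\}$ for all $1\le k\le d$.
   Context: A $\mathbb Z^d$-action is a homomorphism $n\mapsto T_n$ from $\mathbb Z^d$ to the group of probability preserving transformations of $(X,\mathcal B,m)$. A measurable $T$-cocycle is a function $F:\mathbb Z^d\times X\to\mathbb G$, measurable in $x$, with $F(n+k,x)=F(k,x)+F(n,T_kx)$ for $n,k\in\mathbb Z^d$ (identities between measurable functions are understood $m$-almost everywhere). It is bounded if $\sup_{x\in X}\|F(n,x)\|<\infty$ for each $n\in\mathbb Z^d$. The skew product action is $T^{(F)}_n(x,z):=(T_nx,\,z+F(n,x))$ on $X\times\mathbb G$; ergodicity is with respect to $m\times m_{\mathbb G}$, where $m_{\mathbb G}$ is Haar measure on $\mathbb G$. Here $e_1,\dots,e_d$ is the standard basis of $\mathbb R^d$. "Full dimension" means that the real linear span of $\mathbb G$ is $\mathbb R^D$; "symmetric" means $\mathcal S=-\mathcal S$; $\langle\mathcal S\rangle$ is the subgroup generated by $\mathcal S$. *)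

theory Defs
  imports "HOL-Probability.Probability" "HOL-Computational_Algebra.Group_Closure"
begin

text \<open>Identities between measurable maps are understood almost everywhere. The group
  \<open>\<int>\<^sup>d\<close> is \<open>int ^ 'd\<close> and \<open>\<real>\<^sup>D\<close> is \<open>real ^ 'D\<close>.\<close>

text \<open>The Borel structure of some Polish topology on the underlying space; the topology
  is not part of the data.\<close>

definition standard_borel_measure :: "'a measure \<Rightarrow> bool" where
  "standard_borel_measure M \<longleftrightarrow>
     (\<exists>\<T>. topspace \<T> = space M \<and> completely_metrizable_space \<T> \<and> second_countable \<T> \<and>
          sets M = sigma_sets (space M) {U. openin \<T> U})"

definition non_atomic :: "'a measure \<Rightarrow> bool" where
  "non_atomic M \<longleftrightarrow>
     (\<forall>A\<in>sets M. emeasure M A > 0 \<longrightarrow>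
        (\<exists>B\<in>sets M. B \<subseteq> A \<and> 0 < emeasure M B \<and> emeasure M B < emeasure M A))"

text \<open>Invertibility (modulo null sets) of each transformation is a consequence of the
  homomorphism property.\<close>

definition mp_action :: "'a measure \<Rightarrow> ('g::ab_group_add \<Rightarrow> 'a \<Rightarrow> 'a) \<Rightarrow> bool" where
  "mp_action M T \<longleftrightarrow>
     (\<forall>n. T n \<in> M \<rightarrow>\<^sub>M M \<and> distr M M (T n) = M) \<and>
     (AE x in M. T 0 x = x) \<and>
     (\<forall>n k. AE x in M. T (n + k) x = T n (T k x))"

definition ergodic_action :: "'a measure \<Rightarrow> ('g \<Rightarrow> 'a \<Rightarrow> 'a) \<Rightarrow> bool" where
  "ergodic_action M T \<longleftrightarrow>
     (\<forall>A\<in>sets M. (\<forall>n. AE x in M. T n x \<in> A \<longleftrightarrow> x \<in> A) \<longrightarrow>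
        A \<in> null_sets M \<or> space M - A \<in> null_sets M)"

definition additive_subgroup :: "'v::ab_group_add set \<Rightarrow> bool" where
  "additive_subgroup G \<longleftrightarrow> 0 \<in> G \<and> (\<forall>x\<in>G. \<forall>y\<in>G. x + y \<in> G) \<and> (\<forall>x\<in>G. - x \<in> G)"

text \<open>For a closed subgroup \<open>G\<close> of Euclidean space regularity is automatic, so a Haar measure
  is a nonzero translation invariant Borel measure on \<open>G\<close> that is finite on compact sets.
  It is unique up to a positive factor, on which ergodicity does not depend.\<close>

definition haar_measure_on :: "'v::euclidean_space set \<Rightarrow> 'v measure \<Rightarrow> bool" where
  "haar_measure_on G \<mu> \<longleftrightarrow>
     sets \<mu> = sets (restrict_space borel G) \<and>
     (\<forall>g\<in>G. \<forall>A\<in>sets \<mu>. emeasure \<mu> ((\<lambda>z. g + z) ` A) = emeasure \<mu> A) \<and>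
     (\<forall>K. compact K \<and> K \<subseteq> G \<longrightarrow> emeasure \<mu> K < \<infinity>) \<and>
     emeasure \<mu> G \<noteq> 0"

definition cocycle ::
  "'a measure \<Rightarrow> ('g::ab_group_add \<Rightarrow> 'a \<Rightarrow> 'a) \<Rightarrow> 'v::euclidean_space set \<Rightarrow> ('g \<Rightarrow> 'a \<Rightarrow> 'v) \<Rightarrow> bool"
  where
  "cocycle M T G F \<longleftrightarrow>
     (\<forall>n. F n \<in> M \<rightarrow>\<^sub>M restrict_space borel G) \<and>
     (\<forall>n k. AE x in M. F (n + k) x = F k x + F n (T k x))"

definition bounded_cocycle :: "'a measure \<Rightarrow> ('g \<Rightarrow> 'a \<Rightarrow> 'v::euclidean_space) \<Rightarrow> bool" where
  "bounded_cocycle M F \<longleftrightarrow> (\<forall>n. bounded (F n ` space M))"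

definition skew_product ::
  "('g \<Rightarrow> 'a \<Rightarrow> 'a) \<Rightarrow> ('g \<Rightarrow> 'a \<Rightarrow> 'v::ab_group_add) \<Rightarrow> 'g \<Rightarrow> 'a \<times> 'v \<Rightarrow> 'a \<times> 'v" where
  "skew_product T F n = (\<lambda>(x, z). (T n x, z + F n x))"

end

theory Submission
  imports Defs
begin

text \<open>The cocycle is a limit of coboundaries \<open>h (T n x) - h x\<close> of bounded height functions
  \<open>h = \<gamma> \<circ> u\<close>, where \<open>\<gamma> :: int \<Rightarrow> G\<close> is a walk with steps in \<open>S \<union> {0}\<close> and \<open>u\<close> is integer
  valued and changes by at most \<open>1\<close> along the generators. Since \<open>\<int>\<^sup>d\<close> is amenable there are
  almost invariant sets \<open>B\<close> of measure about \<open>1/2\<close>; on a set of small measure near the boundary of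
  \<open>B\<close> the height \<open>u\<close> is pushed down to \<open>0\<close> and then up to a new stretch of the walk, so that deep
  inside \<open>B\<close> the height \<open>h\<close> becomes \<open>h + s\<close> while elsewhere it is unchanged. By ergodicity \<open>B\<close> splits
  every given set \<open>A\<close>, and the two parts of \<open>A\<close> on a level of \<open>u\<close> are matched by group elements along
  which the cocycle is \<open>s\<close>. Doing this for a dense sequence of sets \<open>A\<close> and each \<open>s \<in> S\<close> infinitely
  often makes every \<open>s\<close> an essential value. Sets invariant under the skew product
  are then invariant under translation by \<open>\<langle>S\<rangle>\<close>, hence by \<open>G\<close>, and ergodicity of \<open>T\<close> concludes.\<close>

section \<open>Greedy matching\<close>

text \<open>The rigid demand is that increments along generators lie in
  \<open>S \<union> {0}\<close> exactly, at every stage. Adding \<open>s\<close> to a height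
  directly on \<open>B\<close> would create increments \<open>v + s\<close> across the boundary.
  Therefore all levels are first brought to the common point \<open>\<gamma> 0\<close>, where
  \<open>s\<close> is inserted once, and only integer Lipschitz functions have to be interpolated.
  Because the new stretch retraces the walk and then repeats it, the levels \<open>u\<close> and
  \<open>u + 2 * R + 1\<close> differ by exactly \<open>s\<close> for all \<open>u\<close> at once.
  No convergence of the heights is claimed: what converges are their increments along a fixed group
  element, which lie in one finite set for all stages and change at a given stage only on a set of
  summably small measure. So they are eventually constant, and the values of \<open>S\<close> are
  attained exactly, without approximation in \<open>G\<close>. Only invariance under a dense
  subgroup comes out directly; the closure needs a separate argument. Finally, \<open>B\<close> has
  to split all levels of a set simultaneously, and it is chosen after the tolerances; hence
  splitting is proved quantitatively, uniformly in \<open>B\<close>.\<close>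

locale pmp_action = prob_space M for M :: "'a measure" +
  fixes T :: "'g::{ab_group_add, countable} \<Rightarrow> 'a \<Rightarrow> 'a"
  assumes T_measurable [measurable]: "T n \<in> M \<rightarrow>\<^sub>M M"
    and T_distr: "distr M M (T n) = M"
    and T_zero: "x \<in> space M \<Longrightarrow> T 0 x = x"
    and T_add: "x \<in> space M \<Longrightarrow> T (n + k) x = T n (T k x)"
    and ergodic: "ergodic_action M T"
begin

lemma T_space [simp]: "x \<in> space M \<Longrightarrow> T n x \<in> space M"
  using T_measurable by (rule measurable_space)

lemma T_minus [simp]: "x \<in> space M \<Longrightarrow> T (- n) (T n x) = x"
  using T_add[of x "- n" n] T_zero[of x] by simp

lemma T_minus_right [simp]: "x \<in> space M \<Longrightarrow> T n (T (- n) x) = x"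
  using T_minus[of x "- n"] by simp

lemma measure_T_vimage:
  assumes "A \<in> sets M"
  shows "measure M {x \<in> space M. T n x \<in> A} = measure M A"
proof -
  have "measure M A = measure (distr M M (T n)) A"
    by (simp add: T_distr)
  also have "\<dots> = measure M (T n -` A \<inter> space M)"
    using assms by (subst measure_distr) auto
  also have "T n -` A \<inter> space M = {x \<in> space M. T n x \<in> A}"
    by auto
  finally show ?thesis by simp
qed

lemma AE_T:
  assumes "AE x in M. P x"
  shows "AE x in M. P (T n x)"
proof -
  obtain N where N: "N \<in> null_sets M" "{x \<in> space M. \<not> P x} \<subseteq> N"
    using assms by (auto simp: eventually_ae_filter)
  have "AE x in distr M M (T n). x \<notin> N"
    unfolding T_distr using N(1) by (rule AE_not_in)
  then have "AE x in M. T n x \<notin> N"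
    using N(1) by (subst (asm) AE_distr_iff) auto
  then show ?thesis
    using AE_space by eventually_elim (use N(2) T_space in blast)
qed

definition defect :: "'g \<Rightarrow> 'a set \<Rightarrow> real" where
  "defect n B = measure M {x \<in> space M. x \<in> B \<longleftrightarrow> T n x \<notin> B}"

lemma defect_nonneg [simp]: "0 \<le> defect n B"
  by (simp add: defect_def)

lemma defect_compl: "defect n (space M - B) = defect n B"
  unfolding defect_def by (rule arg_cong[where f = "measure M"]) auto

text \<open>The pair is what is still unmatched in \<open>B\<close> and \<open>C\<close>. Group
  elements are tried in the order of their enumeration. Both components are updated from the same
  old pair, so that the two pieces removed at stage \<open>i\<close> correspond under
  \<open>T (from_nat i)\<close>.\<close>

primrec greedy :: "'a set \<Rightarrow> 'a set \<Rightarrow> nat \<Rightarrow> 'a set \<times> 'a set" where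
  "greedy B C 0 = (B, C)"
| "greedy B C (Suc i) =
     (fst (greedy B C i) - {x. T (from_nat i) x \<in> snd (greedy B C i)},
      snd (greedy B C i) - {x. T (- from_nat i) x \<in> fst (greedy B C i)})"

text \<open>The greedy pieces exhaust \<open>B\<close> or \<open>C\<close>: the orbit of what remains of \<open>C\<close> is an invariant set
  that misses what remains of \<open>B\<close>.\<close>

lemma matching:
  assumes B [measurable]: "B \<in> sets M" and C [measurable]: "C \<in> sets M" and \<epsilon>: "\<epsilon> > 0"
  obtains k :: nat and X Y :: "nat \<Rightarrow> 'a set"
  where "\<And>i. X i \<in> sets M" "\<And>i. Y i \<in> sets M" "\<And>i. X i \<subseteq> B" "\<And>i. Y i \<subseteq> C"
    "\<And>i x. x \<in> X i \<Longrightarrow> T (from_nat i) x \<in> Y i"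
    "disjoint_family X" "disjoint_family Y"
    "min (measure M B) (measure M C) - \<epsilon> \<le> (\<Sum>i<k. measure M (X i))"
proof -
  define b where "b i = fst (greedy B C i)" for i
  define c where "c i = snd (greedy B C i)" for i
  define X where "X i = {x \<in> b i. T (from_nat i) x \<in> c i}" for i
  define Y where "Y i = {x \<in> c i. T (- from_nat i) x \<in> b i}" for i
  have b0: "b 0 = B" and c0: "c 0 = C"
    by (simp_all add: b_def c_def)
  have bS: "b (Suc i) = b i - X i" and cS: "c (Suc i) = c i - Y i" for i
    by (auto simp: b_def c_def X_def Y_def)
  have meas [measurable]: "b i \<in> sets M" "c i \<in> sets M" for i
  proof -
    have "b i \<in> sets M \<and> c i \<in> sets M"
    proof (induction i)
      case 0
      then show ?case by (simp add: b0 c0)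
    next
      case (Suc i)
      then have [measurable]: "b i \<in> sets M" "c i \<in> sets M" by auto
      have "X i = {x \<in> space M. x \<in> b i \<and> T (from_nat i) x \<in> c i}"
        "Y i = {x \<in> space M. x \<in> c i \<and> T (- from_nat i) x \<in> b i}"
        using sets.sets_into_space[OF \<open>b i \<in> sets M\<close>] sets.sets_into_space[OF \<open>c i \<in> sets M\<close>]
        by (auto simp: X_def Y_def)
      then have "X i \<in> sets M" "Y i \<in> sets M" by simp_all
      then show ?case using Suc by (auto simp: bS cS)
    qed
    then show "b i \<in> sets M" "c i \<in> sets M" by auto
  qed
  have bsp: "b i \<subseteq> space M" and csp: "c i \<subseteq> space M" for i
    by (auto dest: subsetD[OF sets.sets_into_space[OF meas(1)]] subsetD[OF sets.sets_into_space[OF meas(2)]])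
  have Xeq: "X i = {x \<in> space M. x \<in> b i \<and> T (from_nat i) x \<in> c i}"
    and Yeq: "Y i = {x \<in> space M. x \<in> c i \<and> T (- from_nat i) x \<in> b i}" for i
    using bsp csp by (auto simp: X_def Y_def)
  have Xm [measurable]: "X i \<in> sets M" and Ym [measurable]: "Y i \<in> sets M" for i
    unfolding Xeq Yeq by measurable
  have TXY: "T (from_nat i) x \<in> Y i" if "x \<in> X i" for i x
    using that bsp[of i] by (auto simp: X_def Y_def subset_eq)
  \<comment> \<open>Since \<open>T (- from_nat i)\<close> is an inverse at every point,
    \<open>X i\<close> is the full preimage of \<open>Y i\<close> and not only a part of it; this
    gives equal measures.\<close>
  have "X i = {x \<in> space M. T (from_nat i) x \<in> Y i}" for i
    using bsp[of i] csp[of i] by (auto simp: X_def Y_def subset_eq)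
  then have mXY: "measure M (X i) = measure M (Y i)" for i
    using measure_T_vimage[OF Ym[of i], of "from_nat i"] by simp
  have decb: "decseq b" and decc: "decseq c"
    by (auto simp: bS cS intro!: decseq_SucI)
  have Xb: "X i \<subseteq> b i" and Yc: "Y i \<subseteq> c i" for i
    by (auto simp: X_def Y_def)
  have disjX: "X i \<inter> X j = {}" and disjY: "Y i \<inter> Y j = {}" if "i < j" for i j
    using that decseqD[OF decb, of "Suc i" j] decseqD[OF decc, of "Suc i" j] Xb[of j] Yc[of j]
    by (auto simp: bS cS)
  have dXY: "disjoint_family X" "disjoint_family Y"
    unfolding disjoint_family_on_def using disjX disjY by (metis Int_commute linorder_neqE_nat)+
  have XB: "X i \<subseteq> B" "Y i \<subseteq> C" for i
    using decseqD[OF decb, of 0 i] decseqD[OF decc, of 0 i] Xb[of i] Yc[of i] by (auto simp: b0 c0)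
  have sumX: "(\<Sum>i<k. measure M (X i)) = measure M B - measure M (b k)"
    and sumY: "(\<Sum>i<k. measure M (X i)) = measure M C - measure M (c k)" for k
  proof -
    have "measure M (b (Suc i)) = measure M (b i) - measure M (X i)" for i
      unfolding bS by (rule finite_measure_Diff) (use Xb in auto)
    then show "(\<Sum>i<k. measure M (X i)) = measure M B - measure M (b k)"
      by (induction k) (auto simp: b0)
    have "measure M (c (Suc i)) = measure M (c i) - measure M (Y i)" for i
      unfolding cS by (rule finite_measure_Diff) (use Yc in auto)
    then show "(\<Sum>i<k. measure M (X i)) = measure M C - measure M (c k)"
      by (induction k) (auto simp: c0 mXY)
  qed
  have "\<exists>k. min (measure M B) (measure M C) - \<epsilon> \<le> (\<Sum>i<k. measure M (X i))"
  proof -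
    define b' where "b' = (\<Inter>i. b i)"
    define c' where "c' = (\<Inter>i. c i)"
    define U where "U = (\<Union>g. {x \<in> space M. T g x \<in> c'})"
    have [measurable]: "b' \<in> sets M" "c' \<in> sets M"
      unfolding b'_def c'_def by auto
    have [measurable]: "U \<in> sets M"
      unfolding U_def by measurable
    have limb: "(\<lambda>k. measure M (b k)) \<longlonglongrightarrow> measure M b'"
      unfolding b'_def by (rule finite_Lim_measure_decseq[OF _ decb]) auto
    have limc: "(\<lambda>k. measure M (c k)) \<longlonglongrightarrow> measure M c'"
      unfolding c'_def by (rule finite_Lim_measure_decseq[OF _ decc]) auto
    have "T n x \<in> U \<longleftrightarrow> x \<in> U" if "x \<in> space M" for n x
    proof
      assume "T n x \<in> U"
      then obtain g where "T g (T n x) \<in> c'" by (auto simp: U_def)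
      then show "x \<in> U" using that by (auto simp: U_def T_add[symmetric])
    next
      assume "x \<in> U"
      then obtain g where "T g x \<in> c'" by (auto simp: U_def)
      moreover have "T g x = T (g + - n) (T n x)"
        using that by (simp add: T_add del: add_uminus_conv_diff)
      ultimately show "T n x \<in> U" using that by (auto simp: U_def)
    qed
    then have "U \<in> null_sets M \<or> space M - U \<in> null_sets M"
      using ergodic unfolding ergodic_action_def by auto
    moreover have "c' \<subseteq> U"
    proof
      fix x assume x: "x \<in> c'"
      then have "x \<in> space M" using csp[of 0] by (auto simp: c'_def)
      then show "x \<in> U" using x T_zero[of x] by (auto simp: U_def intro!: exI[of _ 0])
    qed
    moreover have "b' \<subseteq> space M - U"
    proof
      fix x assume x: "x \<in> b'"
      then have xs: "x \<in> space M" using bsp by (auto simp: b'_def)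
      have "T g x \<notin> c'" for g
      proof
        assume "T g x \<in> c'"
        \<comment> \<open>\<open>x\<close> and \<open>T g x\<close> survive all stages, in
          particular the one that treats \<open>g\<close>, where they would have been
          removed.\<close>
        then have "x \<in> X (to_nat g)" using x by (auto simp: X_def b'_def c'_def)
        then show False using x bS[of "to_nat g"] unfolding b'_def by blast
      qed
      then show "x \<in> space M - U" using xs by (auto simp: U_def)
    qed
    ultimately have "measure M b' = 0 \<or> measure M c' = 0"
      using null_sets_subset[of U M c'] null_sets_subset[of "space M - U" M b']
      by (auto simp: measure_eq_0_null_sets)
    then have "\<exists>k. measure M (b k) < \<epsilon> \<or> measure M (c k) < \<epsilon>"
      using eventually_happens[OF order_tendstoD(2)[OF limb, of \<epsilon>]]
        eventually_happens[OF order_tendstoD(2)[OF limc, of \<epsilon>]] \<epsilon> by auto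
    then obtain k where k: "measure M (b k) < \<epsilon> \<or> measure M (c k) < \<epsilon>" by blast
    show ?thesis
      by (rule exI[of _ k]) (use k sumX[of k] sumY[of k] in linarith)
  qed
  then obtain k where k: "min (measure M B) (measure M C) - \<epsilon> \<le> (\<Sum>i<k. measure M (X i))" ..
  show thesis
    by (rule that[of X Y k]; (rule Xm Ym XB TXY dXY k; assumption?)?)
qed

section \<open>How almost invariant sets meet a given set\<close>

lemma measure_match_le:
  assumes [measurable]: "B \<in> sets M" "X \<in> sets M" "Y \<in> sets M"
    and XY: "\<And>x. x \<in> X \<Longrightarrow> T n x \<in> Y"
  shows "measure M (B \<inter> X) \<le> measure M (B \<inter> Y) + defect n B"
proof -
  have "measure M (B \<inter> X) \<le> measure M ({x \<in> space M. T n x \<in> B \<inter> Y} \<union>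
      {x \<in> space M. x \<in> B \<longleftrightarrow> T n x \<notin> B})"
    using XY sets.sets_into_space[OF assms(1)] by (intro finite_measure_mono) auto
  also have "\<dots> \<le> measure M {x \<in> space M. T n x \<in> B \<inter> Y} + defect n B"
    unfolding defect_def by (rule measure_Un_le) auto
  finally show ?thesis by (simp add: measure_T_vimage del: Int_iff)
qed

text \<open>\<open>W\<close> is matched into \<open>A\<close> as far as possible, and
  \<open>W'\<close> is the rest. A matched point of \<open>B\<close> lands in
  \<open>B \<inter> A\<close> unless a defect counts it. \<open>W'\<close> and \<open>k\<close> are
  fixed before \<open>B\<close>, so finitely many defects serve all \<open>B\<close>.\<close>

lemma domination_step:
  assumes [measurable]: "W \<in> sets M" "A \<in> sets M" and \<epsilon>: "\<epsilon> > 0"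
  obtains W' and k :: nat where "W' \<in> sets M" "W' \<subseteq> W"
    "measure M W' \<le> max 0 (measure M W - measure M A) + \<epsilon>"
    "\<And>B. B \<in> sets M \<Longrightarrow> measure M (B \<inter> (W - W')) \<le> measure M (B \<inter> A) + (\<Sum>i<k. defect (from_nat i) B)"
proof -
  obtain k :: nat and X Y :: "nat \<Rightarrow> 'a set"
    where Xm [measurable]: "\<And>i. X i \<in> sets M" and Ym [measurable]: "\<And>i. Y i \<in> sets M"
      and XW: "\<And>i. X i \<subseteq> W" and YA: "\<And>i. Y i \<subseteq> A"
      and TXY: "\<And>i x. x \<in> X i \<Longrightarrow> T (from_nat i) x \<in> Y i"
      and dX: "disjoint_family X" and dY: "disjoint_family Y"
      and sum: "min (measure M W) (measure M A) - \<epsilon> \<le> (\<Sum>i<k. measure M (X i))"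
    by (rule matching[OF assms]) (rule that)
  define W' where "W' = W - (\<Union>i<k. X i)"
  have sumX: "measure M (\<Union>i<k. X i) = (\<Sum>i<k. measure M (X i))"
    using dX by (intro finite_measure_finite_Union) (auto simp: disjoint_family_on_def)
  have unm: "(\<Union>i<k. X i) \<in> sets M"
    by auto
  have subW: "(\<Union>i<k. X i) \<subseteq> W"
    using XW by auto
  have "measure M W' = measure M W - (\<Sum>i<k. measure M (X i))"
    unfolding W'_def sumX[symmetric] by (rule finite_measure_Diff[OF assms(1) unm subW])
  then have m: "measure M W' \<le> max 0 (measure M W - measure M A) + \<epsilon>"
    using sum by linarith
  have dom: "measure M (B \<inter> (W - W')) \<le>
      measure M (B \<inter> A) + (\<Sum>i<k. defect (from_nat i) B)" if [measurable]: "B \<in> sets M" for B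
  proof -
    have eq: "B \<inter> (W - W') = (\<Union>i<k. B \<inter> X i)"
      using XW by (auto simp: W'_def)
    have "measure M (B \<inter> (W - W')) \<le> (\<Sum>i<k. measure M (B \<inter> X i))"
      unfolding eq by (rule measure_UNION_le) auto
    also have "\<dots> \<le> (\<Sum>i<k. measure M (B \<inter> Y i) + defect (from_nat i) B)"
      by (intro sum_mono measure_match_le) (auto simp: TXY)
    also have "\<dots> = (\<Sum>i<k. measure M (B \<inter> Y i)) + (\<Sum>i<k. defect (from_nat i) B)"
      by (rule sum.distrib)
    also have "(\<Sum>i<k. measure M (B \<inter> Y i)) = measure M (\<Union>i<k. B \<inter> Y i)"
      using dY by (intro finite_measure_finite_Union[symmetric]) (auto simp: disjoint_family_on_def)
    also have "\<dots> \<le> measure M (B \<inter> A)"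
      using YA by (intro finite_measure_mono) auto
    finally show ?thesis by simp
  qed
  show thesis
    by (rule that[of W' k]) (use m dom unm in \<open>auto simp: W'_def\<close>)
qed

text \<open>In each of \<open>j\<close> rounds, what the earlier rounds left of the space is matched
  into the whole of \<open>A\<close> again. Up to \<open>W\<close> the space is then a union of
  \<open>j\<close> pieces, and an almost invariant \<open>B\<close> charges none of them much more
  than it charges \<open>A\<close>.\<close>

lemma domination:
  assumes [measurable]: "A \<in> sets M" and \<epsilon>: "\<epsilon> > 0"
  shows "\<exists>W k. W \<in> sets M \<and> measure M W \<le> max 0 (1 - real j * measure M A) + real j * \<epsilon> \<and>
    (\<forall>B\<in>sets M. measure M (B - W) \<le>
       real j * (measure M (B \<inter> A) + (\<Sum>i<(k::nat). defect (from_nat i) B)))"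
proof (induction j)
  case 0
  have "B - space M = {}" if "B \<in> sets M" for B
    using sets.sets_into_space[OF that] by auto
  then show ?case
    by (intro exI[of _ "space M"]) (simp add: prob_space Diff_eq_empty_iff[THEN iffD2])
next
  case (Suc j)
  then obtain W k where W [measurable]: "W \<in> sets M"
    and mW: "measure M W \<le> max 0 (1 - real j * measure M A) + real j * \<epsilon>"
    and dom: "\<And>B. B \<in> sets M \<Longrightarrow>
      measure M (B - W) \<le> real j * (measure M (B \<inter> A) + (\<Sum>i<(k::nat). defect (from_nat i) B))"
    by blast
  obtain W' and k' :: nat where W' [measurable]: "W' \<in> sets M" and sub: "W' \<subseteq> W"
    and mW': "measure M W' \<le> max 0 (measure M W - measure M A) + \<epsilon>"
    and dom': "\<And>B. B \<in> sets M \<Longrightarrow>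
      measure M (B \<inter> (W - W')) \<le> measure M (B \<inter> A) + (\<Sum>i<k'. defect (from_nat i) B)"
    by (rule domination_step[OF W assms]) (rule that)
  have "measure M W' \<le> max 0 (1 - real (Suc j) * measure M A) + real (Suc j) * \<epsilon>"
  proof -
    have "real (Suc j) * measure M A = real j * measure M A + measure M A"
      "real (Suc j) * \<epsilon> = real j * \<epsilon> + \<epsilon>" "0 \<le> real j * \<epsilon>"
      using \<epsilon> by (simp_all add: algebra_simps)
    then show ?thesis
      using mW mW' \<epsilon> measure_nonneg[of M A] by linarith
  qed
  moreover have "\<forall>B\<in>sets M. measure M (B - W') \<le> real (Suc j) *
      (measure M (B \<inter> A) + (\<Sum>i<max k k'. defect (from_nat i) B))"
  proof
    fix B assume [measurable]: "B \<in> sets M"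
    have "B - W' = (B - W) \<union> (B \<inter> (W - W'))"
      using sub by auto
    then have "measure M (B - W') \<le> measure M (B - W) + measure M (B \<inter> (W - W'))"
      by (simp add: measure_Un_le)
    also have "\<dots> \<le> real j * (measure M (B \<inter> A) + (\<Sum>i<k. defect (from_nat i) B)) +
        (measure M (B \<inter> A) + (\<Sum>i<k'. defect (from_nat i) B))"
      by (intro add_mono dom dom') auto
    also have "\<dots> \<le> real j * (measure M (B \<inter> A) + (\<Sum>i<max k k'. defect (from_nat i) B)) +
        (measure M (B \<inter> A) + (\<Sum>i<max k k'. defect (from_nat i) B))"
      by (intro add_mono mult_left_mono sum_mono2 order_refl) auto
    finally show "measure M (B - W') \<le> real (Suc j) *
        (measure M (B \<inter> A) + (\<Sum>i<max k k'. defect (from_nat i) B))"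
      by (simp add: algebra_simps)
  qed
  ultimately show ?case
    using W' by (intro exI conjI)
qed

text \<open>Quantitative ergodicity: pieces matched into \<open>A\<close> cover nearly everything,
  so a set avoiding most of \<open>A\<close> would avoid most of each piece. Of the measure 1/4, the
  uncovered part and the defects take 1/16 each; the remaining 1/8 loses a factor 2 because
  \<open>j * a\<close> may reach 2.\<close>

lemma splitting:
  assumes A [measurable]: "A \<in> sets M"
  shows "\<exists>(k::nat) \<delta>. \<delta> > 0 \<and> (\<forall>B\<in>sets M. 1/4 \<le> measure M B \<longrightarrow>
    (\<forall>i<k. defect (from_nat i) B \<le> \<delta>) \<longrightarrow> measure M A / 16 \<le> measure M (B \<inter> A))"
proof (cases "measure M A = 0")
  case True
  then show ?thesis by (intro exI[of _ 0] exI[of _ 1]) simp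
next
  case False
  define a where "a = measure M A"
  have a: "0 < a" "a \<le> 1"
    using False by (auto simp: a_def zero_less_measure_iff)
  \<comment> \<open>\<open>j\<close> copies of \<open>A\<close> have total measure between 1 and 2:
    enough to exhaust the space, and few enough to lose only a factor 2.\<close>
  define j where "j = nat \<lceil>1 / a\<rceil>"
  have j: "1 \<le> real j * a" "real j * a \<le> 2"
  proof -
    have "1 / a \<le> real j" "real j \<le> 1 / a + 1"
      using a unfolding j_def by (auto simp: real_nat_ceiling_ge)
    then have "1 / a * a \<le> real j * a" "real j * a \<le> (1 / a + 1) * a"
      using a by (intro mult_right_mono; simp)+
    then show "1 \<le> real j * a" "real j * a \<le> 2"
      using a by (simp_all add: distrib_right)
  qed
  then have j0: "real j > 0" by (cases "j = 0") auto
  obtain W and k :: nat where W [measurable]: "W \<in> sets M"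
    and mW: "measure M W \<le> max 0 (1 - real j * a) + real j * (1 / (16 * real j))"
    and dom: "\<And>B. B \<in> sets M \<Longrightarrow>
      measure M (B - W) \<le> real j * (measure M (B \<inter> A) + (\<Sum>i<k. defect (from_nat i) B))"
    using domination[OF A, of "1 / (16 * real j)" j] j0 unfolding a_def by auto
  have mW: "measure M W \<le> 1 / 16"
    using mW j j0 by auto
  \<comment> \<open>Chosen so that \<open>j\<close> times the sum of \<open>k\<close> defects is at
    most 1/16; \<open>real k + 1\<close> covers the case \<open>k = 0\<close>.\<close>
  define \<delta> where "\<delta> = 1 / (16 * real j * (real k + 1))"
  have "\<delta> > 0" using j0 by (auto simp: \<delta>_def)
  moreover have "measure M A / 16 \<le> measure M (B \<inter> A)"
    if [measurable]: "B \<in> sets M" and B: "measure M B \<ge> 1/4"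
      and d: "\<And>i. i < k \<Longrightarrow> defect (from_nat i) B \<le> \<delta>" for B
  proof -
    have "(\<Sum>i<k. defect (from_nat i) B) \<le> real k * \<delta>"
      using sum_bounded_above[of "{..<k}" "\<lambda>i. defect (from_nat i) B" \<delta>] d by simp
    also have "\<dots> \<le> (real k + 1) * \<delta>"
      using \<open>\<delta> > 0\<close> by (simp add: algebra_simps)
    also have "\<dots> = 1 / (16 * real j)"
    proof -
      have "real k + 1 > 0" by simp
      then show ?thesis using j0 by (simp add: \<delta>_def divide_simps)
    qed
    finally have s: "real j * (\<Sum>i<k. defect (from_nat i) B) \<le> 1 / 16"
      using j0 by (simp add: field_simps)
    have "measure M B \<le> measure M (W \<union> (B - W))"
      by (intro finite_measure_mono) auto
    also have "\<dots> \<le> measure M W + measure M (B - W)"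
      by (rule measure_Un_le) auto
    finally have "1/8 \<le> real j * measure M (B \<inter> A)"
      using B mW s dom[of B] by (simp add: algebra_simps)
    then have "1/8 * a \<le> real j * a * measure M (B \<inter> A)"
      using a by (simp add: mult.commute mult.left_commute)
    also have "\<dots> \<le> 2 * measure M (B \<inter> A)"
      using j by (intro mult_right_mono) auto
    finally show ?thesis by (simp add: a_def)
  qed
  ultimately show ?thesis by blast
qed

end

section \<open>Almost invariant sets\<close>

lemma (in prob_space) expectation_card:
  assumes "finite I" and m: "\<And>i. i \<in> I \<Longrightarrow> {x \<in> space M. P i x} \<in> sets M"
  shows "integrable M (\<lambda>x. real (card {i \<in> I. P i x}))"
    and "expectation (\<lambda>x. real (card {i \<in> I. P i x})) = (\<Sum>i\<in>I. prob {x \<in> space M. P i x})"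
proof -
  have eq: "real (card {i \<in> I. P i x}) = (\<Sum>i\<in>I. indicator {x \<in> space M. P i x} x)"
    if "x \<in> space M" for x
    using that assms(1) by (simp add: indicator_def sum.If_cases Int_def)
  have int: "integrable M (indicator {x \<in> space M. P i x} :: 'a \<Rightarrow> real)" if "i \<in> I" for i
    using m[OF that] by (intro integrable_real_indicator) (auto simp: emeasure_eq_measure)
  show "integrable M (\<lambda>x. real (card {i \<in> I. P i x}))"
    by (subst Bochner_Integration.integrable_cong[OF refl eq]) (use int in auto)
  have "expectation (\<lambda>x. real (card {i \<in> I. P i x})) =
      expectation (\<lambda>x. \<Sum>i\<in>I. indicator {x \<in> space M. P i x} x)"
    by (rule Bochner_Integration.integral_cong[OF refl eq])
  also have "\<dots> = (\<Sum>i\<in>I. expectation (indicator {x \<in> space M. P i x}))"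
    using int by (rule Bochner_Integration.integral_sum)
  also have "\<dots> = (\<Sum>i\<in>I. prob {x \<in> space M. P i x})"
    using m by (intro sum.cong) auto
  finally show "expectation (\<lambda>x. real (card {i \<in> I. P i x})) = (\<Sum>i\<in>I. prob {x \<in> space M. P i x})" .
qed

text \<open>Each step realizes at least half of the gain still possible, so the gain left beyond the
  union is bounded by twice the successive increments, which tend to 0. Countably many steps thus
  replace a transfinite exhaustion.\<close>

lemma (in prob_space) exhaustion:
  assumes sets: "\<And>B. P B \<Longrightarrow> B \<in> sets M" and empty: "P {}"
    and union: "\<And>B :: nat \<Rightarrow> 'a set. incseq B \<Longrightarrow> (\<And>i. P (B i)) \<Longrightarrow> P (\<Union>i. B i)"
    and extend: "\<And>B. P B \<Longrightarrow> prob B < c \<Longrightarrow> \<exists>B'. P B' \<and> B \<subseteq> B' \<and> prob B < prob B'"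
  shows "\<exists>B. P B \<and> c \<le> prob B"
proof -
  have half: "\<exists>B'. P B' \<and> B \<subseteq> B' \<and>
      (\<forall>C. P C \<and> B \<subseteq> C \<longrightarrow> prob C - prob B \<le> 2 * (prob B' - prob B))" if "P B" for B
  proof -
    define s where "s = Sup {prob C | C. P C \<and> B \<subseteq> C}"
    have bdd: "bdd_above {prob C | C. P C \<and> B \<subseteq> C}"
      by (rule bdd_aboveI[of _ 1]) auto
    have s: "prob C \<le> s" if "P C" "B \<subseteq> C" for C
      unfolding s_def using bdd that by (intro cSup_upper) auto
    show ?thesis
    proof (cases "s \<le> prob B")
      case True
      then have "\<forall>C. P C \<and> B \<subseteq> C \<longrightarrow> prob C - prob B \<le> 2 * (prob B - prob B)"
        using s by force
      then show ?thesis using \<open>P B\<close> by blast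
    next
      case False
      then have "(prob B + s) / 2 < s" by simp
      moreover have "{prob C | C. P C \<and> B \<subseteq> C} \<noteq> {}" using that by auto
      ultimately have "\<exists>y\<in>{prob C | C. P C \<and> B \<subseteq> C}. (prob B + s) / 2 < y"
        using less_cSup_iff[OF _ bdd] unfolding s_def by blast
      then obtain B' where B': "P B'" "B \<subseteq> B'" "(prob B + s) / 2 < prob B'"
        by blast
      then have "\<forall>C. P C \<and> B \<subseteq> C \<longrightarrow> prob C - prob B \<le> 2 * (prob B' - prob B)"
        using s by force
      then show ?thesis using B' by blast
    qed
  qed
  have "\<exists>B :: nat \<Rightarrow> 'a set. \<forall>i. P (B i) \<and> (B i \<subseteq> B (Suc i) \<and>
      (\<forall>C. P C \<and> B i \<subseteq> C \<longrightarrow> prob C - prob (B i) \<le> 2 * (prob (B (Suc i)) - prob (B i))))"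
    using empty half by (intro dependent_nat_choice) auto
  then obtain B :: "nat \<Rightarrow> 'a set" where B: "\<And>i. P (B i)"
    and step: "\<And>i. B i \<subseteq> B (Suc i) \<and>
      (\<forall>C. P C \<and> B i \<subseteq> C \<longrightarrow> prob C - prob (B i) \<le> 2 * (prob (B (Suc i)) - prob (B i)))"
    by blast
  define U where "U = (\<Union>i. B i)"
  have inc: "incseq B" using step by (intro incseq_SucI) auto
  have U: "P U" unfolding U_def by (rule union[OF inc B])
  have lim: "(\<lambda>i. prob (B i)) \<longlonglongrightarrow> prob U"
    unfolding U_def by (rule finite_Lim_measure_incseq[OF _ inc]) (use B sets in auto)
  have "c \<le> prob U"
  proof (rule ccontr)
    assume "\<not> c \<le> prob U"
    then obtain C where C: "P C" "U \<subseteq> C" "prob U < prob C"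
      using extend[OF U] by auto
    have "(\<lambda>i. 2 * (prob (B (Suc i)) - prob (B i)) + prob (B i)) \<longlonglongrightarrow> 2 * (prob U - prob U) + prob U"
      by (intro tendsto_intros lim LIMSEQ_Suc)
    moreover have "prob C \<le> 2 * (prob (B (Suc i)) - prob (B i)) + prob (B i)" for i
    proof -
      have "B i \<subseteq> C" using C(2) by (auto simp: U_def)
      then show ?thesis using step[of i] C(1) by force
    qed
    ultimately have "prob C \<le> 2 * (prob U - prob U) + prob U"
      by (intro LIMSEQ_le_const) auto
    then show False using C(3) by simp
  qed
  then show ?thesis using U by blast
qed

locale folner_action = pmp_action M T
  for M :: "'a measure" and T :: "'g::{ab_group_add, countable} \<Rightarrow> 'a \<Rightarrow> 'a" +
  assumes non_atomic: "non_atomic M"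
    and folner: "finite (K :: 'g set) \<Longrightarrow> \<kappa> > 0 \<Longrightarrow>
      \<exists>\<Phi>. finite \<Phi> \<and> \<Phi> \<noteq> {} \<and> (\<forall>k\<in>K. real (card (sym_diff \<Phi> ((+) k ` \<Phi>))) \<le> \<kappa> * real (card \<Phi>))"
begin

text \<open>Of the two parts into which non-atomicity splits a set, one satisfies half the previous
  bound.\<close>

lemma small_subset:
  assumes "A \<in> sets M" "prob A > 0" "\<eta> > 0"
  obtains C where "C \<in> sets M" "C \<subseteq> A" "0 < prob C" "prob C \<le> \<eta>"
proof -
  have ex: "\<exists>C\<in>sets M. C \<subseteq> A \<and> 0 < prob C \<and> prob C \<le> (1/2) ^ n" for n
  proof (induction n)
    case 0
    then show ?case using assms by auto
  next
    case (Suc n)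
    then obtain C where C: "C \<in> sets M" "C \<subseteq> A" "0 < prob C" "prob C \<le> (1/2) ^ n" by auto
    then have "\<exists>B\<in>sets M. B \<subseteq> C \<and> 0 < prob B \<and> ennreal (prob B) < ennreal (prob C)"
      using non_atomic unfolding non_atomic_def emeasure_eq_measure by auto
    then obtain B where B: "B \<in> sets M" "B \<subseteq> C" "0 < prob B" "prob B < prob C"
      by (auto simp: ennreal_less_iff)
    have d: "prob (C - B) = prob C - prob B"
      using B C by (intro finite_measure_Diff) auto
    show ?case
    proof (cases "prob B \<le> (1/2) ^ Suc n")
      case True
      then show ?thesis using B C by (intro bexI[of _ B]) auto
    next
      case False
      then show ?thesis using B C d by (intro bexI[of _ "C - B"]) auto
    qed
  qed
  obtain n where n: "(1/2) ^ n < \<eta>"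
    using real_arch_pow_inv[OF assms(3), of "1/2"] by auto
  obtain C where "C \<in> sets M" "C \<subseteq> A" "0 < prob C" "prob C \<le> (1/2) ^ n"
    using ex[of n] by blast
  then show thesis
    using n by (intro that[of C]) auto
qed

lemma defect_Un:
  assumes [measurable]: "B \<in> sets M" "E \<in> sets M"
  shows "defect n (B \<union> E) \<le> defect n B + defect n E"
proof -
  have "defect n (B \<union> E) \<le> prob ({x \<in> space M. x \<in> B \<longleftrightarrow> T n x \<notin> B} \<union> {x \<in> space M. x \<in> E \<longleftrightarrow> T n x \<notin> E})"
    unfolding defect_def by (intro finite_measure_mono) auto
  also have "\<dots> \<le> defect n B + defect n E"
    unfolding defect_def by (rule measure_Un_le) auto
  finally show ?thesis .
qed

lemma defect_le:
  assumes [measurable]: "E \<in> sets M"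
  shows "defect n E \<le> 2 * prob E"
proof -
  have "defect n E \<le> prob (E \<union> {x \<in> space M. T n x \<in> E})"
    unfolding defect_def by (intro finite_measure_mono) auto
  also have "\<dots> \<le> prob E + prob {x \<in> space M. T n x \<in> E}"
    by (rule measure_Un_le) auto
  finally show ?thesis by (simp add: measure_T_vimage)
qed

text \<open>\<open>f\<close> counts the visits to a tiny set \<open>C\<close> along a Folner set. Its total variation along \<open>K\<close> is
  small relative to its integral off \<open>B\<close>, so by the layer cake formula some level set of \<open>f\<close>
  inherits this.\<close>

lemma almost_invariant_extension:
  assumes B [measurable]: "B \<in> sets M" and half: "prob B < 1/2" and K: "finite K" and \<kappa>: "\<kappa> > 0"
  obtains E where "E \<in> sets M" "prob E \<le> 1/4" "0 < prob (E - B)"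
    "(\<Sum>k\<in>K. defect k E) \<le> \<kappa> * prob (E - B)"
proof -
  \<comment> \<open>The 4 pays for the factor \<open>N / 4\<close> in \<open>mass\<close>,
    \<open>card K\<close> for summing the variation over \<open>K\<close>, and the 1 keeps the
    denominator positive.\<close>
  define \<kappa>' where "\<kappa>' = \<kappa> / (4 * (real (card K) + 1))"
  have \<kappa>': "\<kappa>' > 0" using \<kappa> by (simp add: \<kappa>'_def add_nonneg_pos)
  have K\<kappa>': "real (card K) * \<kappa>' \<le> \<kappa> / 4"
  proof -
    have "real (card K) + 1 > 0" by simp
    then have "(real (card K) + 1) * \<kappa>' = \<kappa> / 4" by (simp add: \<kappa>'_def divide_simps)
    then show ?thesis using \<kappa>' by (simp add: algebra_simps)
  qed
  obtain \<Phi> where \<Phi>: "finite \<Phi>" "\<Phi> \<noteq> {}"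
    and fol: "\<And>k. k \<in> K \<Longrightarrow> real (card (sym_diff \<Phi> ((+) k ` \<Phi>))) \<le> \<kappa>' * real (card \<Phi>)"
    using folner[OF K \<kappa>'] by blast
  define N where "N = card \<Phi>"
  have N: "N > 0" using \<Phi> by (simp add: N_def card_gt_0_iff)
  \<comment> \<open>\<open>w x\<close> counts the elements of \<open>\<Phi>\<close> that move
    \<open>x\<close> backwards out of \<open>B\<close>. Its mean is large because \<open>B\<close>
    has measure below 1/2. Placing \<open>C\<close> where \<open>w\<close> is at least
    \<open>N / 4\<close> guarantees that enough of the mass of \<open>f\<close> sits off
    \<open>B\<close>.\<close>
  define w where "w x = real (card {n \<in> \<Phi>. T (- n) x \<in> space M - B})" for x
  have intw: "integrable M w"
    unfolding w_def using \<Phi> by (intro expectation_card) auto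
  have "expectation w = (\<Sum>n\<in>\<Phi>. prob {x \<in> space M. T (- n) x \<in> space M - B})"
    unfolding w_def using \<Phi> by (intro expectation_card) auto
  also have "\<dots> = (\<Sum>n\<in>\<Phi>. prob (space M - B))"
    by (intro sum.cong refl measure_T_vimage) auto
  also have "\<dots> = real N * (1 - prob B)"
    by (simp add: N_def prob_compl)
  finally have "expectation w = real N * (1 - prob B)" .
  moreover have "real N * (1/2) \<le> real N * (1 - prob B)"
    using half by (intro mult_left_mono) auto
  ultimately have expw: "expectation w > real N / 4"
    using N by linarith
  have [measurable]: "w \<in> borel_measurable M" using intw by auto
  define Z where "Z = {x \<in> space M. real N / 4 \<le> w x}"
  have Z [measurable]: "Z \<in> sets M" unfolding Z_def by measurable
  have "prob Z > 0"
  proof (rule ccontr)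
    assume "\<not> prob Z > 0"
    then have "prob Z = 0" using measure_nonneg[of M Z] by linarith
    then have "AE x in M. x \<notin> Z"
      using Z by (intro AE_not_in null_setsI) (simp_all add: emeasure_eq_measure)
    then have "AE x in M. w x \<le> real N / 4"
      using AE_space by eventually_elim (auto simp: Z_def)
    then have "expectation w \<le> expectation (\<lambda>_. real N / 4)"
      using intw by (intro integral_mono_AE) auto
    then show False using expw by (simp add: prob_space)
  qed
  moreover have "0 < 1 / (4 * real N)"
    using N by simp
  \<comment> \<open>The bound on \<open>prob C\<close> makes the \<open>N\<close> translates of
    \<open>C\<close> together have measure at most 1/4, which bounds every level set of
    \<open>f\<close>.\<close>
  ultimately obtain C where C [measurable]: "C \<in> sets M" and CZ: "C \<subseteq> Z" and C0: "0 < prob C"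
    and CN: "prob C \<le> 1 / (4 * real N)"
    by (rule small_subset[OF Z]) (rule that)
  define f where "f x = card {n \<in> \<Phi>. T n x \<in> C}" for x
  have fN: "f x \<le> N" for x
    unfolding f_def N_def using \<Phi> by (intro card_mono) auto
  have [measurable]: "Measurable.pred M (\<lambda>x. t < f x)" for t
  proof -
    have [measurable]: "(\<lambda>x. real (f x)) \<in> borel_measurable M"
      unfolding f_def using \<Phi> by (intro borel_measurable_integrable expectation_card) auto
    have "Measurable.pred M (\<lambda>x. real t < real (f x))"
      by measurable
    then show ?thesis by simp
  qed
  have [measurable]: "Measurable.pred M (\<lambda>x. t < f (T k x))" for t k
    by (rule measurable_compose[of "T k" M M "\<lambda>x. t < f x"]) measurable
  define E where "E t = {x \<in> space M. t < f x}" for t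
  have E [measurable]: "E t \<in> sets M" for t
    unfolding E_def by measurable
  have smallE: "prob (E t) \<le> 1/4" for t
  proof -
    have "prob (E t) \<le> prob (\<Union>n\<in>\<Phi>. {x \<in> space M. T n x \<in> C})"
    proof (intro finite_measure_mono)
      show "E t \<subseteq> (\<Union>n\<in>\<Phi>. {x \<in> space M. T n x \<in> C})"
        using \<Phi> by (auto simp: E_def f_def card_gt_0_iff dest: le_less_trans[OF le0])
    qed (use \<Phi> in auto)
    also have "\<dots> \<le> (\<Sum>n\<in>\<Phi>. prob {x \<in> space M. T n x \<in> C})"
      using \<Phi> by (intro measure_UNION_le) auto
    also have "\<dots> = real N * prob C"
      by (simp add: measure_T_vimage N_def)
    also have "\<dots> \<le> 1/4"
      using CN N by (simp add: field_simps)
    finally show ?thesis .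
  qed
  \<comment> \<open>Applying \<open>T (- n)\<close> to points of \<open>C\<close> turns the count
    \<open>w\<close> on \<open>C\<close> into the count \<open>f\<close> off \<open>B\<close>;
    slicing \<open>f\<close> by its levels gives the right-hand side.\<close>
  have mass: "real N / 4 * prob C \<le> (\<Sum>t<N. prob (E t - B))"
  proof -
    have "real N / 4 * prob C = expectation (\<lambda>x. real N / 4 * indicator C x)"
      by simp
    also have "\<dots> \<le> expectation (\<lambda>x. real (card {n \<in> \<Phi>. x \<in> C \<and> T (- n) x \<notin> B}))"
    proof (rule integral_mono)
      show "integrable M (\<lambda>x. real (card {n \<in> \<Phi>. x \<in> C \<and> T (- n) x \<notin> B}))"
        using \<Phi> by (intro expectation_card) auto
      show "real N / 4 * indicator C x \<le> real (card {n \<in> \<Phi>. x \<in> C \<and> T (- n) x \<notin> B})"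
        if "x \<in> space M" for x
        using CZ that by (auto simp: Z_def w_def indicator_def)
    qed (auto simp: emeasure_eq_measure)
    also have "\<dots> = (\<Sum>n\<in>\<Phi>. prob {x \<in> space M. x \<in> C \<and> T (- n) x \<notin> B})"
      using \<Phi> by (intro expectation_card) auto
    also have "\<dots> = (\<Sum>n\<in>\<Phi>. prob {x \<in> space M. T n x \<in> C \<and> x \<notin> B})"
    proof (intro sum.cong refl)
      fix n assume "n \<in> \<Phi>"
      have "{x \<in> space M. T n x \<in> C \<and> x \<notin> B} =
          {x \<in> space M. T n x \<in> {x \<in> space M. x \<in> C \<and> T (- n) x \<notin> B}}"
        by auto
      then show "prob {x \<in> space M. x \<in> C \<and> T (- n) x \<notin> B} = prob {x \<in> space M. T n x \<in> C \<and> x \<notin> B}"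
        using measure_T_vimage[of "{x \<in> space M. x \<in> C \<and> T (- n) x \<notin> B}" n] by simp
    qed
    also have "\<dots> = expectation (\<lambda>x. real (card {n \<in> \<Phi>. T n x \<in> C \<and> x \<notin> B}))"
      using \<Phi> by (intro expectation_card(2)[symmetric]) auto
    also have "\<dots> = expectation (\<lambda>x. real (card {t \<in> {..<N}. t < f x \<and> x \<notin> B}))"
    proof (intro Bochner_Integration.integral_cong refl)
      fix x
      have "{t \<in> {..<N}. t < f x} = {..<f x}" using fN[of x] by auto
      then show "real (card {n \<in> \<Phi>. T n x \<in> C \<and> x \<notin> B}) = real (card {t \<in> {..<N}. t < f x \<and> x \<notin> B})"
        by (cases "x \<in> B") (auto simp: f_def)
    qed
    also have "\<dots> = (\<Sum>t<N. prob {x \<in> space M. t < f x \<and> x \<notin> B})"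
      by (intro expectation_card) auto
    also have "\<dots> = (\<Sum>t<N. prob (E t - B))"
      by (intro sum.cong refl arg_cong[where f = prob]) (auto simp: E_def)
    finally show ?thesis .
  qed
  have var: "(\<Sum>t<N. defect k (E t)) \<le> \<kappa>' * real N * prob C" if k: "k \<in> K" for k
  proof -
    \<comment> \<open>The number of levels separating \<open>f x\<close> from
      \<open>f (T k x)\<close> is the distance of the two values. As \<open>f (T k x)\<close> counts
      visits of \<open>x\<close> along \<open>k + \<Phi>\<close>, only visits in the symmetric
      difference contribute.\<close>
    have pw: "card {t \<in> {..<N}. t < f x \<longleftrightarrow> \<not> t < f (T k x)} \<le> card {n \<in> sym_diff \<Phi> ((+) k ` \<Phi>). T n x \<in> C}"
      if x: "x \<in> space M" for x
    proof -
      define Q where "Q = {n. T n x \<in> C}"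
      have fx: "f x = card (\<Phi> \<inter> Q)"
        by (auto simp: f_def Q_def Int_def)
      have "{n \<in> (+) k ` \<Phi>. T n x \<in> C} = (+) k ` {n \<in> \<Phi>. T n (T k x) \<in> C}"
        using T_add[OF x, of _ k] by (auto simp: add.commute)
      then have fTx: "f (T k x) = card ((+) k ` \<Phi> \<inter> Q)"
        by (simp add: f_def Q_def Int_def card_image)
      have le: "card (\<Phi> \<inter> Q) \<le> card ((+) k ` \<Phi> \<inter> Q) + card (sym_diff \<Phi> ((+) k ` \<Phi>) \<inter> Q)"
        "card ((+) k ` \<Phi> \<inter> Q) \<le> card (\<Phi> \<inter> Q) + card (sym_diff \<Phi> ((+) k ` \<Phi>) \<inter> Q)"
        using \<Phi> by (auto intro!: order_trans[OF card_mono card_Un_le])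
      have "card {t \<in> {..<N}. t < f x \<longleftrightarrow> \<not> t < f (T k x)} \<le>
          card ({f x..<f (T k x)} \<union> {f (T k x)..<f x})"
        by (intro card_mono) auto
      also have "\<dots> \<le> (f (T k x) - f x) + (f x - f (T k x))"
        using card_Un_le[of "{f x..<f (T k x)}" "{f (T k x)..<f x}"] by simp
      also have "\<dots> \<le> card (sym_diff \<Phi> ((+) k ` \<Phi>) \<inter> Q)"
        using le unfolding fx fTx by linarith
      finally show ?thesis by (simp add: Q_def Int_def)
    qed
    have "(\<Sum>t<N. defect k (E t)) = (\<Sum>t<N. prob {x \<in> space M. t < f x \<longleftrightarrow> \<not> t < f (T k x)})"
      unfolding defect_def by (intro sum.cong refl arg_cong[where f = prob]) (auto simp: E_def)
    also have "\<dots> = expectation (\<lambda>x. real (card {t \<in> {..<N}. t < f x \<longleftrightarrow> \<not> t < f (T k x)}))"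
      by (intro expectation_card(2)[symmetric]) auto
    also have "\<dots> \<le> expectation (\<lambda>x. real (card {n \<in> sym_diff \<Phi> ((+) k ` \<Phi>). T n x \<in> C}))"
    proof (rule integral_mono)
      show "integrable M (\<lambda>x. real (card {t \<in> {..<N}. t < f x \<longleftrightarrow> \<not> t < f (T k x)}))"
        by (intro expectation_card) auto
      show "integrable M (\<lambda>x. real (card {n \<in> sym_diff \<Phi> ((+) k ` \<Phi>). T n x \<in> C}))"
        using \<Phi> by (intro expectation_card) auto
    qed (use pw in auto)
    also have "\<dots> = (\<Sum>n\<in>sym_diff \<Phi> ((+) k ` \<Phi>). prob {x \<in> space M. T n x \<in> C})"
      using \<Phi> by (intro expectation_card) auto
    also have "\<dots> = real (card (sym_diff \<Phi> ((+) k ` \<Phi>))) * prob C"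
      by (simp add: measure_T_vimage)
    also have "\<dots> \<le> \<kappa>' * real N * prob C"
      using fol[OF k] by (intro mult_right_mono) (auto simp: N_def)
    finally show ?thesis .
  qed
  have total: "(\<Sum>t<N. \<Sum>k\<in>K. defect k (E t)) \<le> (\<Sum>t<N. \<kappa> * prob (E t - B))"
  proof -
    have "(\<Sum>t<N. \<Sum>k\<in>K. defect k (E t)) = (\<Sum>k\<in>K. \<Sum>t<N. defect k (E t))"
      by (rule sum.swap)
    also have "\<dots> \<le> (\<Sum>k\<in>K. \<kappa>' * real N * prob C)"
      by (intro sum_mono var)
    also have "\<dots> = (real (card K) * \<kappa>') * (real N * prob C)"
      by simp
    also have "\<dots> \<le> \<kappa> / 4 * (real N * prob C)"
      using K\<kappa>' by (intro mult_right_mono) auto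
    also have "\<dots> = \<kappa> * (real N / 4 * prob C)"
      by simp
    also have "\<dots> \<le> \<kappa> * (\<Sum>t<N. prob (E t - B))"
      using mass \<kappa> by (intro mult_left_mono) auto
    finally show ?thesis by (simp add: sum_distrib_left)
  qed
  \<comment> \<open>Pigeonhole over the levels: a level with \<open>prob (E t - B) = 0\<close>
    satisfies the reverse inequality trivially, so one strict reverse inequality at a level of
    positive mass contradicts \<open>total\<close>.\<close>
  have "\<exists>t<N. 0 < prob (E t - B) \<and> (\<Sum>k\<in>K. defect k (E t)) \<le> \<kappa> * prob (E t - B)"
  proof (rule ccontr)
    assume neg: "\<not> ?thesis"
    have ge: "\<kappa> * prob (E t - B) \<le> (\<Sum>k\<in>K. defect k (E t))" if "t < N" for t
    proof (cases "prob (E t - B) = 0")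
      case True
      then show ?thesis by (simp add: sum_nonneg)
    next
      case False
      then show ?thesis using neg that by (auto simp: zero_less_measure_iff not_le)
    qed
    have "0 < (\<Sum>t<N. prob (E t - B))"
      using C0 N by (intro less_le_trans[OF _ mass]) auto
    then have "\<not> (\<forall>t\<in>{..<N}. prob (E t - B) \<le> 0)"
      using sum_nonpos[of "{..<N}" "\<lambda>t. prob (E t - B)"] by (intro notI) auto
    then obtain t where t: "t < N" "0 < prob (E t - B)"
      by (auto simp: not_le)
    then have "\<kappa> * prob (E t - B) < (\<Sum>k\<in>K. defect k (E t))"
      using neg by auto
    then have "(\<Sum>t<N. \<kappa> * prob (E t - B)) < (\<Sum>t<N. \<Sum>k\<in>K. defect k (E t))"
      using ge t(1) by (intro sum_strict_mono_ex1) auto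
    then show False using total by simp
  qed
  then show thesis
    using that E smallE by blast
qed

text \<open>Bounding the defects by \<open>\<kappa> * prob B\<close> instead of
  \<open>\<kappa>\<close> makes the property hereditary: an extension \<open>E\<close> pays for its
  defects with the mass \<open>prob (E - B)\<close> that it adds. Extensions start below 1/2 and add
  at most 1/4, whence 3/4; so both \<open>B\<close> and its complement have measure at least 1/4, as
  splitting requires.\<close>

lemma almost_invariant_sets:
  assumes K: "finite K" and \<kappa>: "\<kappa> > 0"
  obtains B where "B \<in> sets M" "1/2 \<le> prob B" "prob B \<le> 3/4" "\<And>k. k \<in> K \<Longrightarrow> defect k B \<le> \<kappa>"
proof -
  define P where "P B \<longleftrightarrow> B \<in> sets M \<and> prob B \<le> 3/4 \<and> (\<Sum>k\<in>K. defect k B) \<le> \<kappa> * prob B" for B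
  have "\<exists>B. P B \<and> 1/2 \<le> prob B"
  proof (rule exhaustion)
    show "P {}" by (auto simp: P_def defect_def)
    show "P (\<Union>i. B i)" if inc: "incseq B" and PB: "\<And>i. P (B i)" for B :: "nat \<Rightarrow> 'a set"
    proof -
      have [measurable]: "B i \<in> sets M" for i using PB by (auto simp: P_def)
      define U where "U = (\<Union>i. B i)"
      have [measurable]: "U \<in> sets M" unfolding U_def by auto
      have lim: "(\<lambda>i. prob (B i)) \<longlonglongrightarrow> prob U"
        unfolding U_def by (rule finite_Lim_measure_incseq[OF _ inc]) auto
      have "prob U \<le> 3/4"
        by (rule LIMSEQ_le_const2[OF lim]) (use PB in \<open>auto simp: P_def\<close>)
      moreover have "(\<Sum>k\<in>K. defect k U) \<le> \<kappa> * prob U"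
      proof -
        have "(\<lambda>i. \<kappa> * prob (B i) + (\<Sum>k\<in>K. 2 * (prob U - prob (B i)))) \<longlonglongrightarrow>
            \<kappa> * prob U + (\<Sum>k\<in>K. 2 * (prob U - prob U))"
          by (intro tendsto_intros lim)
        moreover have "(\<Sum>k\<in>K. defect k U) \<le> \<kappa> * prob (B i) + (\<Sum>k\<in>K. 2 * (prob U - prob (B i)))" for i
        proof -
          have sub: "B i \<subseteq> U" by (auto simp: U_def)
          \<comment> \<open>\<open>U\<close> exceeds \<open>B i\<close> by a tail whose defect is at
            most twice its measure, and that tends to 0.\<close>
          have "defect k U \<le> defect k (B i) + 2 * (prob U - prob (B i))" for k
          proof -
            have "U = B i \<union> (U - B i)" using sub by auto
            then have "defect k U \<le> defect k (B i) + defect k (U - B i)"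
              using defect_Un[of "B i" "U - B i" k] by simp
            also have "defect k (U - B i) \<le> 2 * prob (U - B i)"
              by (rule defect_le) auto
            also have "prob (U - B i) = prob U - prob (B i)"
              using sub by (intro finite_measure_Diff) auto
            finally show ?thesis by simp
          qed
          then have "(\<Sum>k\<in>K. defect k U) \<le> (\<Sum>k\<in>K. defect k (B i) + 2 * (prob U - prob (B i)))"
            by (rule sum_mono)
          then show ?thesis using PB[of i] by (simp add: P_def sum.distrib)
        qed
        ultimately have "(\<Sum>k\<in>K. defect k U) \<le> \<kappa> * prob U + (\<Sum>k\<in>K. 2 * (prob U - prob U))"
          by (intro LIMSEQ_le_const) auto
        then show ?thesis by simp
      qed
      ultimately show ?thesis by (simp add: P_def U_def[symmetric])
    qed
    show "\<exists>B'. P B' \<and> B \<subseteq> B' \<and> prob B < prob B'" if PB: "P B" and "prob B < 1/2" for B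
    proof -
      have [measurable]: "B \<in> sets M" using PB by (simp add: P_def)
      obtain E where [measurable]: "E \<in> sets M" and E: "prob E \<le> 1/4" "0 < prob (E - B)"
        "(\<Sum>k\<in>K. defect k E) \<le> \<kappa> * prob (E - B)"
        by (rule almost_invariant_extension[OF \<open>B \<in> sets M\<close> \<open>prob B < 1/2\<close> K \<kappa>]) (rule that)
      have eq: "prob (B \<union> E) = prob B + prob (E - B)"
        using finite_measure_Union[of B "E - B"] by simp
      have "prob (E - B) \<le> prob E" by (intro finite_measure_mono) auto
      then have "prob (B \<union> E) \<le> 3/4" using eq E \<open>prob B < 1/2\<close> by simp
      moreover have "(\<Sum>k\<in>K. defect k (B \<union> E)) \<le> \<kappa> * prob (B \<union> E)"
      proof -
        have "(\<Sum>k\<in>K. defect k (B \<union> E)) \<le> (\<Sum>k\<in>K. defect k B + defect k E)"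
          by (intro sum_mono defect_Un) auto
        also have "\<dots> \<le> \<kappa> * prob B + \<kappa> * prob (E - B)"
          using PB E by (simp add: sum.distrib P_def)
        finally show ?thesis by (simp add: eq algebra_simps)
      qed
      ultimately have "P (B \<union> E)" by (simp add: P_def)
      then show ?thesis using eq E by (intro exI[of _ "B \<union> E"]) auto
    qed
  qed (simp add: P_def)
  then obtain B where B: "P B" "1/2 \<le> prob B" by blast
  show thesis
  proof (rule that[of B])
    fix k assume "k \<in> K"
    then have "defect k B \<le> (\<Sum>k\<in>K. defect k B)"
      using K by (intro member_le_sum) auto
    also have "\<dots> \<le> \<kappa> * prob B" using B by (simp add: P_def)
    also have "\<dots> \<le> \<kappa> * 1" using \<kappa> by (intro mult_left_mono) auto
    finally show "defect k B \<le> \<kappa>" by simp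
  qed (use B in \<open>auto simp: P_def\<close>)
qed

end

section \<open>One step of the height construction\<close>

definition walk :: "'v::ab_group_add set \<Rightarrow> (int \<Rightarrow> 'v) \<Rightarrow> bool" where
  "walk V \<gamma> \<longleftrightarrow> (\<forall>t. \<gamma> (t + 1) - \<gamma> t \<in> V)"

text \<open>Retrace the walk from \<open>R\<close> back to \<open>0\<close>, make the step \<open>s\<close>, and then repeat it shifted by \<open>s\<close>.\<close>

definition extend_walk :: "int \<Rightarrow> 'v::ab_group_add \<Rightarrow> (int \<Rightarrow> 'v) \<Rightarrow> int \<Rightarrow> 'v" where
  "extend_walk R s \<gamma> t =
     (if t \<le> R then \<gamma> t else if t \<le> 2 * R then \<gamma> (2 * R - t) else \<gamma> (t - 2 * R - 1) + s)"

lemma walk_extend_walk: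
  assumes w: "walk V \<gamma>" and V: "\<And>v. v \<in> V \<Longrightarrow> - v \<in> V" and s: "s \<in> V" and R: "0 \<le> R"
  shows "walk V (extend_walk R s \<gamma>)"
  unfolding walk_def
proof
  fix t
  have step: "\<gamma> (i + 1) - \<gamma> i \<in> V" for i
    using w by (simp add: walk_def)
  have rstep: "\<gamma> i - \<gamma> (i + 1) \<in> V" for i
    using V[OF step[of i]] by simp
  \<comment> \<open>At \<open>t = R\<close> the branches \<open>\<gamma> t\<close> and
    \<open>\<gamma> (2 * R - t)\<close> agree, so this point can open the retracing case. Retracing
    ends at \<open>\<gamma> 0\<close>, where the shifted copy begins, so the step at
    \<open>t = 2 * R\<close> is exactly \<open>s\<close>.\<close>
  consider "t + 1 \<le> R" | "R \<le> t" "t + 1 \<le> 2 * R" | "t = 2 * R" | "2 * R < t"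
    using R by linarith
  then show "extend_walk R s \<gamma> (t + 1) - extend_walk R s \<gamma> t \<in> V"
  proof cases
    case 1
    then show ?thesis using step[of t] by (simp add: extend_walk_def)
  next
    case 2
    then have "extend_walk R s \<gamma> t = \<gamma> (2 * R - t)" "extend_walk R s \<gamma> (t + 1) = \<gamma> (2 * R - t - 1)"
      by (auto simp: extend_walk_def algebra_simps)
    then show ?thesis using rstep[of "2 * R - t - 1"] by simp
  next
    case 3
    then have "extend_walk R s \<gamma> t = \<gamma> 0" "extend_walk R s \<gamma> (t + 1) = \<gamma> 0 + s"
      using R by (auto simp: extend_walk_def)
    then show ?thesis using s by simp
  next
    case 4
    then have "extend_walk R s \<gamma> t = \<gamma> (t - 2 * R - 1) + s"
      "extend_walk R s \<gamma> (t + 1) = \<gamma> (t - 2 * R - 1 + 1) + s"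
      using R by (auto simp: extend_walk_def)
    then show ?thesis using step[of "t - 2 * R - 1"] by simp
  qed
qed

text \<open>As \<open>p\<close> grows from \<open>0\<close>, the height \<open>u \<in> [0, R]\<close> is clipped down to \<open>0\<close>, carried up
  to \<open>2 * R + 1\<close>, and then released to \<open>u + 2 * R + 1\<close>.\<close>

definition lift :: "int \<Rightarrow> int \<Rightarrow> int \<Rightarrow> int" where
  "lift R p u = max (min u (R - p)) (min (p - R) (2 * R + 1 + u))"

text \<open>A generator may change \<open>u\<close> and \<open>p\<close> at the same time, so the
  two changes must not add up. They do not: \<open>max\<close> and \<open>min\<close> are
  1-Lipschitz for the maximum norm, and each innermost argument involves only one of
  \<open>u\<close> and \<open>p\<close>.\<close>

lemma lift_lipschitz:
  assumes "\<bar>u - u'\<bar> \<le> 1" "\<bar>p - p'\<bar> \<le> 1"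
  shows "\<bar>lift R p u - lift R p' u'\<bar> \<le> 1"
proof -
  have max: "\<bar>max a b - max a' b'\<bar> \<le> 1" if "\<bar>a - a'\<bar> \<le> 1" "\<bar>b - b'\<bar> \<le> 1" for a b a' b' :: int
    using that by linarith
  have min: "\<bar>min a b - min a' b'\<bar> \<le> 1" if "\<bar>a - a'\<bar> \<le> 1" "\<bar>b - b'\<bar> \<le> 1" for a b a' b' :: int
    using that by linarith
  show ?thesis
    unfolding lift_def using assms by (intro max min) linarith+
qed

lemma lift_bounds: "0 \<le> u \<Longrightarrow> u \<le> R \<Longrightarrow> 0 \<le> lift R p u \<and> lift R p u \<le> 1 + 3 * R"
  unfolding lift_def by linarith

lemma lift_0: "0 \<le> u \<Longrightarrow> u \<le> R \<Longrightarrow> lift R 0 u = u"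
  unfolding lift_def by linarith

lemma lift_top: "0 \<le> u \<Longrightarrow> u \<le> R \<Longrightarrow> lift R (4 * R + 1) u = 2 * R + 1 + u"
  unfolding lift_def by linarith

locale generated_action = folner_action M T
  for M :: "'a measure" and T :: "'g::{ab_group_add, countable} \<Rightarrow> 'a \<Rightarrow> 'a" +
  fixes E :: "'g set"
  assumes finite_E: "finite E"
begin

section \<open>Word balls and the depth of a point inside a set\<close>

primrec word_ball :: "nat \<Rightarrow> 'g set" where
  "word_ball 0 = {0}"
| "word_ball (Suc l) = word_ball l \<union> (\<Union>e\<in>E. (\<lambda>n. n + e) ` word_ball l \<union> (\<lambda>n. n - e) ` word_ball l)"

lemma finite_word_ball: "finite (word_ball l)"
  by (induction l) (auto simp: finite_E)

lemma word_ball_mono: "i \<le> j \<Longrightarrow> word_ball i \<subseteq> word_ball j"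
  by (rule lift_Suc_mono_le[of word_ball]) auto

lemma zero_in_word_ball: "0 \<in> word_ball l"
  using word_ball_mono[of 0 l] by auto

text \<open>As the balls are nested, counting the radii below \<open>L\<close> that fit into
  \<open>B\<close> gives the word distance along the orbit from \<open>x\<close> to the complement
  of \<open>B\<close>, truncated at \<open>L\<close>.\<close>

definition depth :: "'a set \<Rightarrow> nat \<Rightarrow> 'a \<Rightarrow> nat" where
  "depth B L x = card {l \<in> {..<L}. \<forall>n\<in>word_ball l. T n x \<in> B}"

text \<open>The ball of radius \<open>l - 1\<close> about \<open>T e x\<close> lies in the ball of
  radius \<open>l\<close> about \<open>x\<close>, so a single radius is lost. The condition on
  \<open>e\<close> is met by the generators and by their inverses.\<close>

lemma depth_le:
  assumes x: "x \<in> space M" and e: "\<And>l n. n \<in> word_ball l \<Longrightarrow> n + e \<in> word_ball (Suc l)"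
  shows "depth B L x \<le> depth B L (T e x) + 1"
proof -
  have "l = 0 \<or> l \<in> Suc ` {l \<in> {..<L}. \<forall>n\<in>word_ball l. T n (T e x) \<in> B}"
    if "l < L" "\<forall>n\<in>word_ball l. T n x \<in> B" for l
  proof (cases l)
    case (Suc i)
    have "T n (T e x) \<in> B" if "n \<in> word_ball i" for n
      using bspec[OF \<open>\<forall>n\<in>word_ball l. T n x \<in> B\<close>, of "n + e"] e[OF that] Suc
      by (simp add: T_add[OF x])
    then show ?thesis using Suc \<open>l < L\<close> by auto
  qed auto
  then have "{l \<in> {..<L}. \<forall>n\<in>word_ball l. T n x \<in> B} \<subseteq>
      insert 0 (Suc ` {l \<in> {..<L}. \<forall>n\<in>word_ball l. T n (T e x) \<in> B})"
    by blast
  then have "depth B L x \<le> card (insert 0 (Suc ` {l \<in> {..<L}. \<forall>n\<in>word_ball l. T n (T e x) \<in> B}))"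
    unfolding depth_def by (intro card_mono) auto
  also have "\<dots> \<le> depth B L (T e x) + 1"
    unfolding depth_def by (subst card_insert_if) (auto simp: card_image)
  finally show ?thesis .
qed

lemma depth_lipschitz:
  assumes x: "x \<in> space M" and e: "e \<in> E"
  shows "\<bar>int (depth B L (T e x)) - int (depth B L x)\<bar> \<le> 1"
proof -
  have "depth B L x \<le> depth B L (T e x) + 1"
    using x e by (intro depth_le) auto
  moreover have "depth B L (T e x) \<le> depth B L (T (- e) (T e x)) + 1"
    using x e by (intro depth_le) auto
  ultimately show ?thesis using x by simp
qed

lemma depth_outside: "x \<in> space M \<Longrightarrow> x \<notin> B \<Longrightarrow> depth B L x = 0"
  unfolding depth_def using zero_in_word_ball T_zero[of x] by (auto intro!: bexI[of _ 0])

lemma depth_inside: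
  assumes "\<And>n. n \<in> word_ball L \<Longrightarrow> T n x \<in> B"
  shows "depth B L x = L"
proof -
  have "{l \<in> {..<L}. \<forall>n\<in>word_ball l. T n x \<in> B} = {..<L}"
    using assms word_ball_mono by (auto dest: subsetD[OF word_ball_mono, OF less_imp_le])
  then show ?thesis by (simp add: depth_def)
qed

lemma depth_measurable [measurable]:
  assumes [measurable]: "B \<in> sets M"
  shows "depth B L \<in> measurable M (count_space UNIV)"
proof -
  have "Measurable.pred M (\<lambda>x. depth B L x = c)" for c
  proof -
    have [measurable]: "Measurable.pred M (\<lambda>x. \<forall>n\<in>word_ball l. T n x \<in> B)" for l
      using finite_word_ball[of l] by measurable
    have "(\<lambda>x. real (depth B L x)) \<in> borel_measurable M"
      unfolding depth_def by (intro borel_measurable_integrable expectation_card) auto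
    then have "Measurable.pred M (\<lambda>x. real (depth B L x) = real c)"
      by measurable
    then show ?thesis by simp
  qed
  then show ?thesis
    by (intro measurable_count_space_eq_countable[THEN iffD2])
      (auto simp: pred_def vimage_def Int_def conj_commute)
qed

section \<open>Heights and matchings\<close>

definition lipschitz :: "('a \<Rightarrow> int) \<Rightarrow> bool" where
  "lipschitz u \<longleftrightarrow> (\<forall>e\<in>E. \<forall>x\<in>space M. \<bar>u (T e x) - u x\<bar> \<le> 1)"

text \<open>Heights factor through a walk, since \<open>int\<close>-valued Lipschitz functions are stable
  under truncation, whereas there is no such retraction in the Cayley graph of a general group.\<close>

definition height :: "'v::ab_group_add set \<Rightarrow> ('a \<Rightarrow> 'v) \<Rightarrow> bool" where
  "height V h \<longleftrightarrow> (\<exists>\<gamma> u (R::nat). walk V \<gamma> \<and> u \<in> measurable M (count_space UNIV) \<and>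
     (\<forall>x\<in>space M. 0 \<le> u x \<and> u x \<le> int R) \<and> lipschitz u \<and> (\<forall>x\<in>space M. h x = \<gamma> (u x)))"

text \<open>An index consists of a level of the height and the position of a group element in the
  enumeration. Finiteness puts all elements used into a finite \<open>K\<close>, which later stages
  can protect. Disjointness on both sides lets an exceptional set be charged only once in the sum
  over the pieces.\<close>

definition matched :: "('a \<Rightarrow> 'v::ab_group_add) \<Rightarrow> 'a set \<Rightarrow> 'v \<Rightarrow> 'g set \<Rightarrow> bool" where
  "matched h A s K \<longleftrightarrow> (\<exists>(I :: (nat \<times> nat) set) X Y. finite I \<and>
     (\<forall>i\<in>I. from_nat (snd i) \<in> K \<and> X i \<in> sets M \<and> Y i \<in> sets M \<and> X i \<subseteq> A \<and> Y i \<subseteq> A \<and>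
        (\<forall>x\<in>X i. T (from_nat (snd i)) x \<in> Y i \<and> h (T (from_nat (snd i)) x) - h x = s)) \<and>
     disjoint_family_on X I \<and> disjoint_family_on Y I \<and> prob A / 32 \<le> (\<Sum>i\<in>I. prob (X i)))"

lemma height_zero: "0 \<in> V \<Longrightarrow> height V (\<lambda>_. 0)"
  unfolding height_def
  by (intro exI[of _ "\<lambda>_. 0"] exI[of _ 0]) (auto simp: walk_def lipschitz_def)

lemma matched_null: "prob A = 0 \<Longrightarrow> matched h A s K"
  unfolding matched_def by (intro exI[of _ "{}"]) (auto simp: disjoint_family_on_def)

text \<open>Increments along \<open>g\<close> change only if \<open>x\<close> or
  \<open>T g x\<close> is in the transition zone \<open>mid\<close>, or if exactly one of them is in
  \<open>B\<close>; otherwise both heights move by the same amount, 0 or \<open>s\<close>. Matched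
  points lie on one level of \<open>u\<close>, so the old height contributes nothing to their
  difference and the new one exactly \<open>s\<close>.\<close>

lemma height_step:
  fixes h :: "'a \<Rightarrow> 'v::ab_group_add"
  assumes h: "height V h" and V: "\<And>v. v \<in> V \<Longrightarrow> - v \<in> V" and s: "s \<in> V"
    and A [measurable]: "A \<in> sets M" and A0: "prob A > 0" and K: "finite K" and \<epsilon>: "\<epsilon> > 0"
  shows "\<exists>h' K'. height V h' \<and> finite K' \<and> matched h' A s K' \<and>
    (\<forall>g\<in>K. prob {x \<in> space M. h' (T g x) - h' x \<noteq> h (T g x) - h x} \<le> \<epsilon>)"
proof -
  obtain \<gamma> u and R :: nat where \<gamma>: "walk V \<gamma>" and u [measurable]: "u \<in> measurable M (count_space UNIV)"
    and uR: "\<And>x. x \<in> space M \<Longrightarrow> 0 \<le> u x \<and> u x \<le> int R" and lip: "lipschitz u"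
    and hu: "\<And>x. x \<in> space M \<Longrightarrow> h x = \<gamma> (u x)"
    using h unfolding height_def by blast
  \<comment> \<open>At most \<open>R\<close> units of depth clip the height to 0,
    \<open>2 * R + 1\<close> more carry it past the retraced stretch, and the last \<open>R\<close>
    release every height up to \<open>R\<close>.\<close>
  define L where "L = 4 * R + 1"
  define a where "a r = {x \<in> A. u x = int r}" for r
  have Asp: "A \<subseteq> space M" using A by (rule sets.sets_into_space)
  have "a r = {x \<in> space M. x \<in> A \<and> u x = int r}" for r
    using Asp by (auto simp: a_def)
  then have a [measurable]: "a r \<in> sets M" for r by simp
  have suma: "(\<Sum>r\<le>R. prob (a r)) = prob A"
  proof -
    have "A = (\<Union>r\<in>{..R}. a r)"
    proof
      show "A \<subseteq> (\<Union>r\<in>{..R}. a r)"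
      proof
        fix x assume x: "x \<in> A"
        then have "0 \<le> u x \<and> u x \<le> int R" using uR Asp by auto
        then show "x \<in> (\<Union>r\<in>{..R}. a r)"
          using x by (intro UN_I[of "nat (u x)"]) (auto simp: a_def)
      qed
    qed (auto simp: a_def)
    moreover have "prob (\<Union>r\<in>{..R}. a r) = (\<Sum>r\<le>R. prob (a r))"
      by (intro finite_measure_finite_Union) (auto simp: disjoint_family_on_def a_def)
    ultimately show ?thesis by simp
  qed
  \<comment> \<open>First bound: \<open>mid\<close>, its preimage and one defect cost at most
    \<open>3 * \<eta>\<close>. Second bound: each of the \<open>R + 1\<close> levels loses
    \<open>\<eta>\<close> to \<open>mid\<close> and \<open>\<eta>\<close> to incomplete matching, in
    all at most 1/32 of \<open>prob A\<close>, which leaves 1/32 of the guaranteed 1/16.\<close>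
  define \<eta> where "\<eta> = min (\<epsilon> / 4) (prob A / (64 * (real R + 1)))"
  have "0 < prob A / (64 * (real R + 1))"
    using A0 by (simp add: add_nonneg_pos)
  then have \<eta>: "\<eta> > 0" "\<eta> \<le> \<epsilon> / 4" "\<eta> \<le> prob A / (64 * (real R + 1))"
    unfolding \<eta>_def using \<epsilon> by linarith+
  have "\<forall>r. \<exists>kd::nat \<times> real. snd kd > 0 \<and> (\<forall>B\<in>sets M. 1/4 \<le> prob B \<longrightarrow>
      (\<forall>i<fst kd. defect (from_nat i) B \<le> snd kd) \<longrightarrow> prob (a r) / 16 \<le> prob (B \<inter> a r))"
  proof
    fix r
    obtain k :: nat and \<delta> :: real where "\<delta> > 0" "\<forall>B\<in>sets M. 1/4 \<le> prob B \<longrightarrow>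
        (\<forall>i<k. defect (from_nat i) B \<le> \<delta>) \<longrightarrow> prob (a r) / 16 \<le> prob (B \<inter> a r)"
      using splitting[OF a[of r]] by blast
    then show "\<exists>kd::nat \<times> real. snd kd > 0 \<and> (\<forall>B\<in>sets M. 1/4 \<le> prob B \<longrightarrow>
      (\<forall>i<fst kd. defect (from_nat i) B \<le> snd kd) \<longrightarrow> prob (a r) / 16 \<le> prob (B \<inter> a r))"
      by (intro exI[of _ "(k, \<delta>)"]) auto
  qed
  from choice[OF this] obtain kd :: "nat \<Rightarrow> nat \<times> real" where kd': "\<forall>r. snd (kd r) > 0 \<and>
      (\<forall>B\<in>sets M. 1/4 \<le> prob B \<longrightarrow>
        (\<forall>i<fst (kd r). defect (from_nat i) B \<le> snd (kd r)) \<longrightarrow> prob (a r) / 16 \<le> prob (B \<inter> a r))" ..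
  have kd: "snd (kd r) > 0" for r
    using kd' by blast
  have split: "prob (a r) / 16 \<le> prob (B \<inter> a r)"
    if "B \<in> sets M" "1/4 \<le> prob B" "\<And>i. i < fst (kd r) \<Longrightarrow> defect (from_nat i) B \<le> snd (kd r)" for r B
    using kd' that by blast
  \<comment> \<open>The second entry bounds \<open>mid\<close> through a union over the word ball of
    radius \<open>L\<close>; the others serve the increments along \<open>K\<close> and the
    splitting of every level.\<close>
  define \<kappa> where "\<kappa> = Min (insert \<eta> (insert (\<eta> / (real (card (word_ball L)) + 1)) ((\<lambda>r. snd (kd r)) ` {..R})))"
  have \<kappa>: "\<kappa> > 0"
    unfolding \<kappa>_def using \<eta> kd by (subst Min_gr_iff) (auto simp: add_nonneg_pos)
  have \<kappa>_le: "\<kappa> \<le> \<eta>" "\<kappa> \<le> \<eta> / (real (card (word_ball L)) + 1)" "\<And>r. r \<le> R \<Longrightarrow> \<kappa> \<le> snd (kd r)"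
    unfolding \<kappa>_def by (rule Min_le; auto)+
  have "finite (K \<union> word_ball L \<union> (\<Union>r\<le>R. from_nat ` {..<fst (kd r)}))"
    using K finite_word_ball by auto
  then obtain B where B [measurable]: "B \<in> sets M" and B1: "1/2 \<le> prob B" and B2: "prob B \<le> 3/4"
    and dB: "\<And>k. k \<in> K \<union> word_ball L \<union> (\<Union>r\<le>R. from_nat ` {..<fst (kd r)}) \<Longrightarrow> defect k B \<le> \<kappa>"
    by (rule almost_invariant_sets[OF _ \<kappa>]) (rule that)
  have Bsp: "B \<subseteq> space M" using B by (rule sets.sets_into_space)
  define p where "p x = int (depth B L x)" for x
  have p [measurable]: "p \<in> measurable M (count_space UNIV)"
    unfolding p_def by measurable
  define mid where "mid = {x \<in> space M. x \<in> B \<and> p x \<noteq> int L}"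
  have mid [measurable]: "mid \<in> sets M" unfolding mid_def by measurable
  have p_out: "p x = 0" if "x \<in> space M" "x \<notin> B" for x
    using depth_outside[OF that] by (simp add: p_def)
  have mid_le: "prob mid \<le> \<eta>"
  proof -
    have "prob mid \<le> prob (\<Union>n\<in>word_ball L. {x \<in> space M. x \<in> B \<longleftrightarrow> T n x \<notin> B})"
    proof (intro finite_measure_mono subsetI)
      fix x assume "x \<in> mid"
      then have x: "x \<in> space M" "x \<in> B" "depth B L x \<noteq> L" by (auto simp: mid_def p_def)
      then obtain n where "n \<in> word_ball L" "T n x \<notin> B" using depth_inside[of L x B] by blast
      then show "x \<in> (\<Union>n\<in>word_ball L. {x \<in> space M. x \<in> B \<longleftrightarrow> T n x \<notin> B})" using x by auto
    qed (use finite_word_ball in auto)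
    also have "\<dots> \<le> (\<Sum>n\<in>word_ball L. defect n B)"
      unfolding defect_def using finite_word_ball by (intro measure_UNION_le) auto
    also have "\<dots> \<le> real (card (word_ball L)) * \<kappa>"
      using sum_bounded_above[of "word_ball L" "\<lambda>n. defect n B" \<kappa>] dB by auto
    also have "\<dots> \<le> (real (card (word_ball L)) + 1) * (\<eta> / (real (card (word_ball L)) + 1))"
      using \<kappa>_le(2) \<kappa> by (intro mult_mono) auto
    also have "\<dots> = \<eta>"
    proof -
      have "real (card (word_ball L)) + 1 > 0" by simp
      then show ?thesis by (simp add: divide_simps)
    qed
    finally show ?thesis .
  qed
  \<comment> \<open>On each level, \<open>lo\<close> is where the height stays and \<open>hi\<close>
    is where it has completed its rise by \<open>s\<close>; the transition zone is left out of
    both.\<close>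
  define lo where "lo r = a r - B" for r
  define hi where "hi r = {x \<in> a r. x \<in> B \<and> p x = int L}" for r
  have asp: "a r \<subseteq> space M" for r using a by (rule sets.sets_into_space)
  have lo [measurable]: "lo r \<in> sets M" for r unfolding lo_def by measurable
  have "hi r = {x \<in> space M. x \<in> a r \<and> x \<in> B \<and> p x = int L}" for r
    using asp by (auto simp: hi_def)
  then have hi [measurable]: "hi r \<in> sets M" for r by simp
  have lo_ge: "prob (a r) / 16 \<le> prob (lo r)" if "r \<le> R" for r
  proof -
    have "prob (a r) / 16 \<le> prob ((space M - B) \<inter> a r)"
    proof (rule split)
      show "1/4 \<le> prob (space M - B)" using B2 by (simp add: prob_compl)
      show "defect (from_nat i) (space M - B) \<le> snd (kd r)" if "i < fst (kd r)" for i
        unfolding defect_compl using that \<open>r \<le> R\<close> by (intro order_trans[OF dB \<kappa>_le(3)]) auto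
    qed auto
    also have "(space M - B) \<inter> a r = lo r" using asp by (auto simp: lo_def)
    finally show ?thesis .
  qed
  have hi_ge: "prob (a r) / 16 - \<eta> \<le> prob (hi r)" if "r \<le> R" for r
  proof -
    have "prob (a r) / 16 \<le> prob (B \<inter> a r)"
    proof (rule split)
      show "1/4 \<le> prob B" using B1 by simp
      show "defect (from_nat i) B \<le> snd (kd r)" if "i < fst (kd r)" for i
        using that \<open>r \<le> R\<close> by (intro order_trans[OF dB \<kappa>_le(3)]) auto
    qed auto
    also have "\<dots> \<le> prob (hi r \<union> mid)"
      using asp by (intro finite_measure_mono) (auto simp: hi_def mid_def)
    also have "\<dots> \<le> prob (hi r) + prob mid"
      by (rule measure_Un_le) auto
    finally show ?thesis using mid_le by linarith
  qed
  have "\<forall>r. \<exists>q :: nat \<times> (nat \<Rightarrow> 'a set) \<times> (nat \<Rightarrow> 'a set). case q of (k, X, Y) \<Rightarrow>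
      (\<forall>i. X i \<in> sets M \<and> Y i \<in> sets M \<and> X i \<subseteq> lo r \<and> Y i \<subseteq> hi r \<and>
         (\<forall>x\<in>X i. T (from_nat i) x \<in> Y i)) \<and> disjoint_family X \<and> disjoint_family Y \<and>
      min (prob (lo r)) (prob (hi r)) - \<eta> \<le> (\<Sum>i<k. prob (X i))"
  proof
    fix r
    obtain k :: nat and X Y :: "nat \<Rightarrow> 'a set"
      where "\<And>i. X i \<in> sets M" "\<And>i. Y i \<in> sets M" "\<And>i. X i \<subseteq> lo r" "\<And>i. Y i \<subseteq> hi r"
        "\<And>i x. x \<in> X i \<Longrightarrow> T (from_nat i) x \<in> Y i" "disjoint_family X" "disjoint_family Y"
        "min (prob (lo r)) (prob (hi r)) - \<eta> \<le> (\<Sum>i<k. prob (X i))"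
      by (rule matching[OF lo[of r] hi[of r] \<eta>(1)]) (rule that)
    then show "\<exists>q :: nat \<times> (nat \<Rightarrow> 'a set) \<times> (nat \<Rightarrow> 'a set). case q of (k, X, Y) \<Rightarrow>
      (\<forall>i. X i \<in> sets M \<and> Y i \<in> sets M \<and> X i \<subseteq> lo r \<and> Y i \<subseteq> hi r \<and>
         (\<forall>x\<in>X i. T (from_nat i) x \<in> Y i)) \<and> disjoint_family X \<and> disjoint_family Y \<and>
      min (prob (lo r)) (prob (hi r)) - \<eta> \<le> (\<Sum>i<k. prob (X i))"
      by (intro exI[of _ "(k, X, Y)"]) simp
  qed
  from choice[OF this] obtain q :: "nat \<Rightarrow> nat \<times> (nat \<Rightarrow> 'a set) \<times> (nat \<Rightarrow> 'a set)" where "\<forall>r. case q r of (k, X, Y) \<Rightarrow>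
      (\<forall>i. X i \<in> sets M \<and> Y i \<in> sets M \<and> X i \<subseteq> lo r \<and> Y i \<subseteq> hi r \<and>
         (\<forall>x\<in>X i. T (from_nat i) x \<in> Y i)) \<and> disjoint_family X \<and> disjoint_family Y \<and>
      min (prob (lo r)) (prob (hi r)) - \<eta> \<le> (\<Sum>i<k. prob (X i))" ..
  note q = spec[OF this]
  define k where "k r = fst (q r)" for r
  define X where "X ri = fst (snd (q (fst ri))) (snd ri)" for ri
  define Y where "Y ri = snd (snd (q (fst ri))) (snd ri)" for ri
  have XY: "X (r, i) \<in> sets M" "Y (r, i) \<in> sets M" "X (r, i) \<subseteq> lo r" "Y (r, i) \<subseteq> hi r"
    "\<And>x. x \<in> X (r, i) \<Longrightarrow> T (from_nat i) x \<in> Y (r, i)" for r i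
    using q[of r] by (auto simp: X_def Y_def split: prod.splits)
  have disj: "i \<noteq> j \<Longrightarrow> X (r, i) \<inter> X (r, j) = {}" "i \<noteq> j \<Longrightarrow> Y (r, i) \<inter> Y (r, j) = {}" for r i j
    using q[of r] by (auto simp: X_def Y_def disjoint_family_on_def split: prod.splits)
  have sumX: "min (prob (lo r)) (prob (hi r)) - \<eta> \<le> (\<Sum>i<k r. prob (X (r, i)))" for r
    using q[of r] by (auto simp: X_def k_def split: prod.splits)
  define I where "I = Sigma {..R} (\<lambda>r. {..<k r})"
  define u' where "u' x = lift (int R) (p x) (u x)" for x
  define \<gamma>' where "\<gamma>' = extend_walk (int R) s \<gamma>"
  define h' where "h' x = \<gamma>' (u' x)" for x
  have [measurable]: "u' \<in> measurable M (count_space UNIV)"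
    unfolding u'_def
    by (rule measurable_compose_countable[OF _ p], rule measurable_compose[OF u]) simp
  have "lipschitz u'"
    unfolding lipschitz_def u'_def using lip depth_lipschitz
    by (intro ballI lift_lipschitz) (auto simp: lipschitz_def p_def)
  then have height: "height V h'"
    unfolding height_def h'_def
    using walk_extend_walk[OF \<gamma> V s, of "int R"] lift_bounds[OF conjunct1[OF uR] conjunct2[OF uR]]
    by (intro exI[of _ \<gamma>'] exI[of _ u'] exI[of _ "3 * R + 1"]) (auto simp: \<gamma>'_def u'_def)
  have h'_out: "h' x = h x" if "x \<in> space M" "x \<notin> B" for x
    using uR[OF that(1)] p_out[OF that]
    by (simp add: h'_def u'_def \<gamma>'_def lift_0 extend_walk_def hu[OF that(1)])
  have h'_in: "h' x = h x + s" if "x \<in> space M" "p x = int L" for x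
    using uR[OF that(1)] lift_top[of "u x" "int R"] that(2)
    by (simp add: h'_def u'_def \<gamma>'_def extend_walk_def hu[OF that(1)] L_def algebra_simps)
  have disjXY: "X ri \<inter> X ri' = {} \<and> Y ri \<inter> Y ri' = {}" if "ri \<noteq> ri'" for ri ri' :: "nat \<times> nat"
  proof -
    obtain r i r' i' where eq: "ri = (r, i)" "ri' = (r', i')"
      by (cases ri, cases ri')
    show ?thesis
    proof (cases "r = r'")
      case True
      then show ?thesis using that disj[of i i' r] by (auto simp: eq)
    next
      case False
      then show ?thesis
        using XY(3,4)[of r i] XY(3,4)[of r' i'] by (auto simp: eq lo_def hi_def a_def subset_eq)
    qed
  qed
  have "matched h' A s (from_nat ` snd ` I)"
    unfolding matched_def
  proof (intro exI conjI ballI)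
    show "finite I" by (auto simp: I_def)
    fix ri assume ri: "ri \<in> I"
    obtain r i where ri': "ri = (r, i)" by (cases ri)
    show "from_nat (snd ri) \<in> from_nat ` snd ` I" using ri by auto
    show "X ri \<in> sets M" "Y ri \<in> sets M" using XY ri' by auto
    show "X ri \<subseteq> A" "Y ri \<subseteq> A"
      using XY(3,4)[of r i] by (auto simp: ri' lo_def hi_def a_def)
    fix x assume x: "x \<in> X ri"
    then have Tx: "T (from_nat i) x \<in> hi r" "x \<in> lo r"
      using XY(3,4)[of r i] XY(5)[of x r i] by (auto simp: ri')
    then have sp: "x \<in> space M" "T (from_nat i) x \<in> space M"
      using asp[of r] by (auto simp: lo_def hi_def)
    show "T (from_nat (snd ri)) x \<in> Y ri"
      using x XY(5) by (simp add: ri')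
    have "h' (T (from_nat i) x) = h (T (from_nat i) x) + s"
      using Tx sp by (intro h'_in) (auto simp: hi_def)
    moreover have "h' x = h x"
      using Tx sp by (intro h'_out) (auto simp: lo_def)
    moreover have "h (T (from_nat i) x) = h x"
      using Tx sp by (simp add: hu lo_def hi_def a_def)
    ultimately show "h' (T (from_nat (snd ri)) x) - h' x = s" by (simp add: ri')
  next
    show "disjoint_family_on X I" "disjoint_family_on Y I"
      using disjXY by (auto simp: disjoint_family_on_def)
  next
    have "prob A / 16 - 2 * \<eta> * (real R + 1) = (\<Sum>r\<le>R. prob (a r) / 16 - 2 * \<eta>)"
      by (simp add: sum_subtractf sum_divide_distrib[symmetric] suma algebra_simps)
    also have "\<dots> \<le> (\<Sum>r\<le>R. \<Sum>i<k r. prob (X (r, i)))"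
    proof (intro sum_mono)
      fix r assume "r \<in> {..R}"
      then have "prob (a r) / 16 \<le> prob (lo r)" "prob (a r) / 16 - \<eta> \<le> prob (hi r)"
        using lo_ge hi_ge by auto
      then show "prob (a r) / 16 - 2 * \<eta> \<le> (\<Sum>i<k r. prob (X (r, i)))"
        using sumX[of r] \<eta>(1) by linarith
    qed
    also have "\<dots> = (\<Sum>ri\<in>I. prob (X ri))"
      unfolding I_def by (subst sum.Sigma) auto
    finally have "prob A / 16 - 2 * \<eta> * (real R + 1) \<le> (\<Sum>ri\<in>I. prob (X ri))" .
    moreover have "2 * \<eta> * (real R + 1) \<le> prob A / 32"
    proof -
      have "real R + 1 > 0" by simp
      then show ?thesis using \<eta>(3) by (simp add: field_simps)
    qed
    ultimately show "prob A / 32 \<le> (\<Sum>ri\<in>I. prob (X ri))" by linarith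
  qed
  moreover have "finite (from_nat ` snd ` I :: 'g set)" by (auto simp: I_def)
  moreover have "\<forall>g\<in>K. prob {x \<in> space M. h' (T g x) - h' x \<noteq> h (T g x) - h x} \<le> \<epsilon>"
  proof
    fix g assume g: "g \<in> K"
    have "prob {x \<in> space M. h' (T g x) - h' x \<noteq> h (T g x) - h x} \<le>
        prob ((mid \<union> {x \<in> space M. T g x \<in> mid}) \<union> {x \<in> space M. x \<in> B \<longleftrightarrow> T g x \<notin> B})"
    proof (intro finite_measure_mono subsetI)
      fix x assume "x \<in> {x \<in> space M. h' (T g x) - h' x \<noteq> h (T g x) - h x}"
      then have x: "x \<in> space M" "T g x \<in> space M" and ne: "h' (T g x) - h' x \<noteq> h (T g x) - h x"
        by auto
      show "x \<in> (mid \<union> {x \<in> space M. T g x \<in> mid}) \<union> {x \<in> space M. x \<in> B \<longleftrightarrow> T g x \<notin> B}"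
      proof (rule ccontr)
        assume no: "\<not> ?thesis"
        show False
        proof (cases "x \<in> B")
          case True
          then have "h' x = h x + s" "h' (T g x) = h (T g x) + s"
            using no x by (auto intro!: h'_in simp: mid_def)
          then show False using ne by simp
        next
          case False
          then have "h' x = h x" "h' (T g x) = h (T g x)"
            using no x by (auto intro!: h'_out)
          then show False using ne by simp
        qed
      qed
    qed auto
    also have "\<dots> \<le> prob (mid \<union> {x \<in> space M. T g x \<in> mid}) + defect g B"
      unfolding defect_def by (rule measure_Un_le) auto
    also have "prob (mid \<union> {x \<in> space M. T g x \<in> mid}) \<le> prob mid + prob {x \<in> space M. T g x \<in> mid}"
      by (rule measure_Un_le) auto
    also have "prob {x \<in> space M. T g x \<in> mid} = prob mid"
      by (rule measure_T_vimage) auto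
    also have "defect g B \<le> \<kappa>" using g by (intro dB) auto
    finally show "prob {x \<in> space M. h' (T g x) - h' x \<noteq> h (T g x) - h x} \<le> \<epsilon>"
      using mid_le \<kappa>_le(1) \<eta> by linarith
  qed
  ultimately show ?thesis using height by blast
qed

end

section \<open>The limit cocycle\<close>

text \<open>Terms for the algebra generated by a sequence of sets. Countability of the datatype
  yields an enumeration of this algebra.\<close>

datatype set_term = Basic nat | Compl set_term | Join set_term set_term

instance set_term :: countable
  by countable_datatype

primrec interp :: "'a set \<Rightarrow> (nat \<Rightarrow> 'a set) \<Rightarrow> set_term \<Rightarrow> 'a set" where
  "interp \<Omega> b (Basic i) = b i"
| "interp \<Omega> b (Compl \<phi>) = \<Omega> - interp \<Omega> b \<phi>"
| "interp \<Omega> b (Join \<phi> \<psi>) = interp \<Omega> b \<phi> \<union> interp \<Omega> b \<psi>"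

text \<open>The sets that the algebra approximates in measure form a sigma-algebra containing the
  generators: complements have the same symmetric difference, and a countable union is first cut
  down to a finite one.\<close>

lemma (in prob_space) countably_generated_dense:
  fixes b :: "nat \<Rightarrow> 'a set"
  assumes b: "\<And>i. b i \<in> sets M" and gen: "sets M = sigma_sets (space M) (range b)"
  obtains C :: "nat \<Rightarrow> 'a set" where "\<And>n. C n \<in> sets M"
    "\<And>A \<epsilon>. A \<in> sets M \<Longrightarrow> \<epsilon> > 0 \<Longrightarrow> \<exists>n. prob (sym_diff A (C n)) < \<epsilon>"
proof -
  let ?I = "interp (space M) b"
  have I [measurable]: "?I \<phi> \<in> sets M" for \<phi>
    by (induction \<phi>) (auto simp: b)
  have empty: "?I (Compl (Join (Basic 0) (Compl (Basic 0)))) = {}"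
    by auto
  have dense: "\<forall>\<epsilon>>0. \<exists>\<phi>. prob (sym_diff A (?I \<phi>)) < \<epsilon>" if "A \<in> sets M" for A
    using that[unfolded gen]
  proof (induction rule: sigma_sets.induct)
    case (Basic a)
    then obtain i where "a = b i" by auto
    then show ?case by (intro allI impI exI[of _ "Basic i"]) auto
  next
    case Empty
    show ?case
      by (intro allI impI exI[of _ "Compl (Join (Basic 0) (Compl (Basic 0)))"]) (simp add: empty del: interp.simps)
  next
    case (Compl a)
    have "a \<subseteq> space M"
      using Compl(1) sets.sets_into_space[of a M] by (simp add: gen)
    have eq: "sym_diff (space M - a) (?I (set_term.Compl \<phi>)) = sym_diff a (?I \<phi>)" for \<phi>
      using \<open>a \<subseteq> space M\<close> sets.sets_into_space[OF I[of \<phi>]] by auto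
    show ?case
    proof (intro allI impI)
      fix \<epsilon> :: real assume "\<epsilon> > 0"
      then obtain \<phi> where "prob (sym_diff a (?I \<phi>)) < \<epsilon>" using Compl.IH by blast
      then show "\<exists>\<phi>. prob (sym_diff (space M - a) (?I \<phi>)) < \<epsilon>"
        by (intro exI[of _ "set_term.Compl \<phi>"]) (simp only: eq)
    qed
  next
    case (Union a)
    have a [measurable]: "a i \<in> sets M" for i using Union(1) by (simp add: gen)
    have fin: "\<forall>\<epsilon>>0. \<exists>\<phi>. prob (sym_diff (\<Union>i<n. a i) (?I \<phi>)) < \<epsilon>" for n :: nat
    proof (induction n)
      case 0
      show ?case
        by (intro allI impI exI[of _ "Compl (Join (Basic 0) (Compl (Basic 0)))"]) (simp add: empty del: interp.simps)
    next
      case (Suc n)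
      show ?case
      proof (intro allI impI)
        fix \<epsilon> :: real assume "\<epsilon> > 0"
        then have "\<epsilon> / 2 > 0" by simp
        then obtain \<phi> \<psi> where \<phi>: "prob (sym_diff (\<Union>i<n. a i) (?I \<phi>)) < \<epsilon> / 2"
          and \<psi>: "prob (sym_diff (a n) (?I \<psi>)) < \<epsilon> / 2"
          using Suc.IH Union.IH by meson
        have "prob (sym_diff (\<Union>i<Suc n. a i) (?I (Join \<phi> \<psi>))) \<le>
            prob (sym_diff (\<Union>i<n. a i) (?I \<phi>) \<union> sym_diff (a n) (?I \<psi>))"
          by (intro finite_measure_mono) (auto simp: less_Suc_eq)
        also have "\<dots> \<le> prob (sym_diff (\<Union>i<n. a i) (?I \<phi>)) + prob (sym_diff (a n) (?I \<psi>))"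
          by (intro measure_Un_le) auto
        finally show "\<exists>\<phi>. prob (sym_diff (\<Union>i<Suc n. a i) (?I \<phi>)) < \<epsilon>"
          using \<phi> \<psi> by (intro exI[of _ "Join \<phi> \<psi>"]) linarith
      qed
    qed
    show ?case
    proof (intro allI impI)
      fix \<epsilon> :: real assume "\<epsilon> > 0"
      define U where "U = (\<Union>i. a i)"
      have [measurable]: "U \<in> sets M" unfolding U_def by auto
      have "(\<lambda>n. prob (\<Union>i<n. a i)) \<longlonglongrightarrow> prob (\<Union>n. \<Union>i<n. a i)"
        by (intro finite_Lim_measure_incseq incseq_SucI) (auto simp: less_Suc_eq)
      also have "(\<Union>n. \<Union>i<n. a i) = U" unfolding U_def by auto
      finally have "(\<lambda>n. prob (\<Union>i<n. a i)) \<longlonglongrightarrow> prob U" .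
      then have "eventually (\<lambda>n. prob (\<Union>i<n. a i) > prob U - \<epsilon> / 2) sequentially"
        using \<open>\<epsilon> > 0\<close> by (intro order_tendstoD) auto
      then obtain n where n: "prob (\<Union>i<n. a i) > prob U - \<epsilon> / 2"
        by (auto dest: eventually_happens)
      have "\<epsilon> / 2 > 0" using \<open>\<epsilon> > 0\<close> by simp
      then obtain \<phi> where \<phi>: "prob (sym_diff (\<Union>i<n. a i) (?I \<phi>)) < \<epsilon> / 2"
        using fin by blast
      have "prob (U - (\<Union>i<n. a i)) = prob U - prob (\<Union>i<n. a i)"
        by (intro finite_measure_Diff) (auto simp: U_def)
      moreover have "prob (sym_diff U (?I \<phi>)) \<le>
          prob ((U - (\<Union>i<n. a i)) \<union> sym_diff (\<Union>i<n. a i) (?I \<phi>))"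
        by (intro finite_measure_mono) (auto simp: U_def)
      moreover have "\<dots> \<le> prob (U - (\<Union>i<n. a i)) + prob (sym_diff (\<Union>i<n. a i) (?I \<phi>))"
        by (intro measure_Un_le) auto
      ultimately have "prob (sym_diff U (?I \<phi>)) < \<epsilon>"
        using n \<phi> by linarith
      then show "\<exists>\<phi>. prob (sym_diff (\<Union>i. a i) (?I \<phi>)) < \<epsilon>"
        by (auto simp: U_def)
    qed
  qed
  show thesis
  proof (rule that[of "\<lambda>n. ?I (from_nat n)"])
    fix A and \<epsilon> :: real assume "A \<in> sets M" "\<epsilon> > 0"
    then obtain \<phi> where "prob (sym_diff A (?I \<phi>)) < \<epsilon>" using dense by blast
    then show "\<exists>n. prob (sym_diff A (?I (from_nat n))) < \<epsilon>"
      by (intro exI[of _ "to_nat \<phi>"]) simp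
  qed simp
qed

lemma standard_borel_countably_generated:
  assumes "standard_borel_measure M"
  obtains b :: "nat \<Rightarrow> 'a set" where "\<And>i. b i \<in> sets M" "sets M = sigma_sets (space M) (range b)"
proof -
  obtain \<T> where \<T>: "topspace \<T> = space M" "second_countable \<T>"
    and sets: "sets M = sigma_sets (space M) {U. openin \<T> U}"
    using assms unfolding standard_borel_measure_def by blast
  obtain \<B> where \<B>: "countable \<B>" "\<And>V. V \<in> \<B> \<Longrightarrow> openin \<T> V"
    and base: "\<And>U x. openin \<T> U \<Longrightarrow> x \<in> U \<Longrightarrow> \<exists>V\<in>\<B>. x \<in> V \<and> V \<subseteq> U"
    using \<T>(2) unfolding second_countable_def by metis
  \<comment> \<open>Adjoining \<open>{}\<close> makes the family nonempty, so that
    \<open>from_nat_into\<close> enumerates exactly its members.\<close>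
  define b where "b = from_nat_into (insert {} \<B>)"
  have rb: "range b = insert {} \<B>"
    unfolding b_def using \<B>(1) by (intro range_from_nat_into) auto
  have bM: "b i \<in> sets M" for i
  proof -
    have "openin \<T> (b i)" using rangeI[of b i] \<B>(2) unfolding rb by auto
    then show ?thesis unfolding sets by auto
  qed
  have "sigma_sets (space M) {U. openin \<T> U} = sigma_sets (space M) (range b)"
  proof (rule sigma_sets_eqI)
    fix U assume "U \<in> {U. openin \<T> U}"
    then have U: "openin \<T> U" by simp
    have "U = \<Union>{V \<in> \<B>. V \<subseteq> U}" using base[OF U] by blast
    moreover have "\<Union>{V \<in> \<B>. V \<subseteq> U} \<in> sigma_sets (space M) (range b)"
      using \<B>(1) by (intro sigma_sets_UNION) (auto simp: rb)
    ultimately show "U \<in> sigma_sets (space M) (range b)" by simp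
  next
    fix U assume "U \<in> range b"
    then show "U \<in> sigma_sets (space M) {U. openin \<T> U}"
      using bM unfolding sets by auto
  qed
  then show thesis using that[of b] bM sets by simp
qed

section \<open>A sequence of heights and the limit of its coboundaries\<close>

context generated_action
begin

lemma matched_mono: "matched h A s K \<Longrightarrow> K \<subseteq> K' \<Longrightarrow> matched h A s K'"
  unfolding matched_def by (elim exE, rename_tac I X Y, rule_tac x = I in exI, rule_tac x = X in exI,
    rule_tac x = Y in exI) (elim conjE, intro conjI; auto)

lemma height_measurable:
  assumes "height V h"
  shows "h \<in> borel_measurable M"
proof -
  obtain \<gamma> u and R :: nat where "walk V \<gamma>" and u: "u \<in> measurable M (count_space UNIV)"
    and "\<forall>x\<in>space M. 0 \<le> u x \<and> u x \<le> int R" "lipschitz u" and hu: "\<forall>x\<in>space M. h x = \<gamma> (u x)"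
    using assms unfolding height_def by (elim exE conjE)
  have "(\<lambda>x. \<gamma> (u x)) \<in> borel_measurable M"
    by (rule measurable_compose[OF u]) simp
  then show ?thesis
    using hu by (subst measurable_cong[of M h]) auto
qed

text \<open>\<open>K\<close> records the elements whose increments are protected from then on:
  \<open>from_nat j\<close>, so that the limit exists along every element, and those used by the
  matching at stage \<open>j\<close>, so that it survives. The tolerance is divided by the size of
  \<open>K j\<close> to leave \<open>(1/2) ^ j\<close> for the union over
  \<open>K j\<close>.\<close>

lemma height_sequence:
  fixes V :: "'v::ab_group_add set"
  assumes V: "0 \<in> V" "\<And>v. v \<in> V \<Longrightarrow> - v \<in> V" and s: "\<And>j. s j \<in> V" and A: "\<And>j. A j \<in> sets M"
  obtains h :: "nat \<Rightarrow> 'a \<Rightarrow> 'v" and K :: "nat \<Rightarrow> 'g set"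
  where "\<And>j. height V (h j)" "\<And>j. finite (K j)" "incseq K" "\<And>j. from_nat j \<in> K (Suc j)"
    "\<And>j. matched (h (Suc j)) (A j) (s j) (K (Suc j))"
    "\<And>j g. g \<in> K j \<Longrightarrow> prob {x \<in> space M. h (Suc j) (T g x) - h (Suc j) x \<noteq> h j (T g x) - h j x}
       \<le> (1/2) ^ j / (real (card (K j)) + 1)"
proof -
  define P where "P j hK \<longleftrightarrow> height V (fst hK) \<and> finite (snd hK)" for j :: nat and hK :: "('a \<Rightarrow> 'v) \<times> 'g set"
  define Q where "Q j hK hK' \<longleftrightarrow> snd hK \<subseteq> snd hK' \<and> from_nat j \<in> snd hK' \<and>
      matched (fst hK') (A j) (s j) (snd hK') \<and>
      (\<forall>g\<in>snd hK. prob {x \<in> space M. fst hK' (T g x) - fst hK' x \<noteq> fst hK (T g x) - fst hK x}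
         \<le> (1/2) ^ j / (real (card (snd hK)) + 1))" for j :: nat and hK hK' :: "('a \<Rightarrow> 'v) \<times> 'g set"
  have "\<exists>f. \<forall>j. P j (f j) \<and> Q j (f j) (f (Suc j))"
  proof (rule dependent_nat_choice)
    show "\<exists>hK. P 0 hK"
      using height_zero[OF V(1)] by (intro exI[of _ "(\<lambda>_. 0, {})"]) (simp add: P_def)
    fix hK :: "('a \<Rightarrow> 'v) \<times> 'g set" and j assume "P j hK"
    then have h: "height V (fst hK)" and K: "finite (snd hK)" by (auto simp: P_def)
    define \<epsilon> where "\<epsilon> = (1/2) ^ j / (real (card (snd hK)) + 1)"
    have \<epsilon>: "\<epsilon> > 0" by (simp add: \<epsilon>_def add_nonneg_pos)
    have "\<exists>h' K'. height V h' \<and> finite K' \<and> matched h' (A j) (s j) K' \<and>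
      (\<forall>g\<in>snd hK. prob {x \<in> space M. h' (T g x) - h' x \<noteq> fst hK (T g x) - fst hK x} \<le> \<epsilon>)"
    proof (cases "prob (A j) = 0")
      case True
      then show ?thesis
        using h matched_null[OF True] \<epsilon> by (intro exI[of _ "fst hK"] exI[of _ "{}"]) auto
    next
      case False
      then show ?thesis
        using height_step[OF h V(2) s A _ K \<epsilon>] by (simp add: zero_less_measure_iff)
    qed
    then obtain h' K' where h': "height V h'" "finite K'" "matched h' (A j) (s j) K'"
      "\<forall>g\<in>snd hK. prob {x \<in> space M. h' (T g x) - h' x \<noteq> fst hK (T g x) - fst hK x} \<le> \<epsilon>"
      by blast
    have "P (Suc j) (h', snd hK \<union> K' \<union> {from_nat j})"
      using h' K by (simp add: P_def)
    moreover have "Q j hK (h', snd hK \<union> K' \<union> {from_nat j})"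
      using h' unfolding Q_def \<epsilon>_def by (auto intro: matched_mono)
    ultimately show "\<exists>hK'. P (Suc j) hK' \<and> Q j hK hK'" by blast
  qed
  then obtain f where f: "\<And>j. P j (f j)" "\<And>j. Q j (f j) (f (Suc j))" by blast
  show thesis
  proof (rule that[of "\<lambda>j. fst (f j)" "\<lambda>j. snd (f j)"])
    show "incseq (\<lambda>j. snd (f j))"
      using f(2) by (intro incseq_SucI) (auto simp: Q_def)
  qed (use f in \<open>auto simp: P_def Q_def\<close>)
qed

lemma height_generator:
  assumes h: "height V h" and V: "0 \<in> V" "\<And>v. v \<in> V \<Longrightarrow> - v \<in> V"
    and e: "e \<in> E" and x: "x \<in> space M"
  shows "h (T e x) - h x \<in> V"
proof -
  obtain \<gamma> u where \<gamma>: "walk V \<gamma>" and lip: "lipschitz u" and hu: "\<And>x. x \<in> space M \<Longrightarrow> h x = \<gamma> (u x)"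
    using h unfolding height_def by auto
  have step: "\<gamma> (i + 1) - \<gamma> i \<in> V" for i
    using \<gamma> by (simp add: walk_def)
  have "\<bar>u (T e x) - u x\<bar> \<le> 1" using lip e x by (auto simp: lipschitz_def)
  then consider "u (T e x) = u x" | "u (T e x) = u x + 1" | "u x = u (T e x) + 1" by linarith
  then show ?thesis
  proof cases
    case 3
    then show ?thesis using V(2)[OF step[of "u (T e x)"]] x by (simp add: hu)
  qed (use step V x in \<open>auto simp: hu\<close>)
qed

text \<open>\<open>W\<close> depends on \<open>n\<close> but not on the height. Heights have no
  common bound \<open>R\<close>, yet their increments along \<open>n\<close> stay in one finite set,
  and this passes to the limit.\<close>

lemma height_increments:
  assumes V: "finite V" "0 \<in> V" "\<And>v. v \<in> V \<Longrightarrow> - v \<in> V" and n: "n \<in> group_closure E"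
  shows "\<exists>W. finite W \<and> W \<subseteq> group_closure V \<and>
    (\<forall>h. height V h \<longrightarrow> (\<forall>x\<in>space M. h (T n x) - h x \<in> W))"
  using n
proof induction
  case (base e)
  have "h (T e x) - h x \<in> V" if "height V h" "x \<in> space M" for h x
    using base height_generator[OF that(1) V(2,3) _ that(2)] V(2) T_zero[OF that(2)] by auto
  then show ?case using V(1) by (intro exI[of _ V] conjI) (auto intro: group_closure.base)
next
  case (diff a b)
  from diff.IH(1) obtain Wa where Wa: "finite Wa" "Wa \<subseteq> group_closure V"
    "\<forall>h. height V h \<longrightarrow> (\<forall>x\<in>space M. h (T a x) - h x \<in> Wa)" by (elim exE conjE)
  from diff.IH(2) obtain Wb where Wb: "finite Wb" "Wb \<subseteq> group_closure V"
    "\<forall>h. height V h \<longrightarrow> (\<forall>x\<in>space M. h (T b x) - h x \<in> Wb)" by (elim exE conjE)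
  define W where "W = (\<lambda>(v, w). v - w) ` (Wa \<times> Wb)"
  have "h (T (a - b) x) - h x \<in> W" if h: "height V h" and x: "x \<in> space M" for h x
  proof -
    define y where "y = T (- b) x"
    have y: "y \<in> space M" "T b y = x" "T a y = T (a - b) x"
      using x T_add[of x a "- b"] by (auto simp: y_def)
    have pair: "(h (T a y) - h y, h (T b y) - h y) \<in> Wa \<times> Wb"
      using Wa(3) Wb(3) h y(1) by simp
    have "h (T (a - b) x) - h x = (h (T a y) - h y) - (h (T b y) - h y)"
      by (simp add: y)
    then show ?thesis
      using imageI[OF pair, of "\<lambda>(v, w). v - w"] unfolding W_def by (simp only: prod.case)
  qed
  moreover have "finite W" "W \<subseteq> group_closure V"
    using Wa(1,2) Wb(1,2) by (auto simp: W_def intro!: group_closure.diff)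
  ultimately show ?case by (intro exI[of _ W]) auto
qed

text \<open>By Borel-Cantelli the increments along each element are eventually constant almost
  everywhere. The last clause concerns arbitrary \<open>A\<close>, whereas matchings are made for a
  dense sequence; since the pieces are disjoint, the approximation error enters only once on each
  side of the matching.\<close>

lemma essential_cocycle:
  fixes V G :: "'v::euclidean_space set"
  assumes V: "finite V" "0 \<in> V" "\<And>v. v \<in> V \<Longrightarrow> - v \<in> V" and gen: "group_closure E = UNIV"
    and cg: "\<And>i. b i \<in> sets M" "sets M = sigma_sets (space M) (range (b :: nat \<Rightarrow> 'a set))"
  obtains F where "\<And>n. F n \<in> borel_measurable M" "\<And>n. finite (F n ` space M)"
    "\<And>n. F n ` space M \<subseteq> group_closure V" "\<And>n x. n \<in> E \<Longrightarrow> x \<in> space M \<Longrightarrow> F n x \<in> V"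
    "\<And>n k. AE x in M. F (n + k) x = F k x + F n (T k x)"
    "\<And>A v. A \<in> sets M \<Longrightarrow> 0 < prob A \<Longrightarrow> v \<in> V \<Longrightarrow>
       \<exists>g. 0 < prob {x \<in> space M. x \<in> A \<and> T g x \<in> A \<and> F g x = v}"
proof -
  obtain C :: "nat \<Rightarrow> 'a set" where C [measurable]: "\<And>n. C n \<in> sets M"
    and dense: "\<And>A \<epsilon>. A \<in> sets M \<Longrightarrow> \<epsilon> > 0 \<Longrightarrow> \<exists>n. prob (sym_diff A (C n)) < \<epsilon>"
    by (rule countably_generated_dense[OF cg]) (rule that)
  \<comment> \<open>\<open>j\<close> encodes \<open>(n, (i, r))\<close>. The component
    \<open>r\<close> enters neither \<open>v\<close> nor \<open>c\<close>, so every pair of a set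
    \<open>C n\<close> and a value recurs at arbitrarily late stages.\<close>
  define v where "v j = from_nat_into V (fst (prod_decode (snd (prod_decode j))))" for j
  define c where "c j = C (fst (prod_decode j))" for j
  have vV: "v j \<in> V" for j
    unfolding v_def using V by (intro from_nat_into) auto
  have cM: "c j \<in> sets M" for j by (simp add: c_def)
  have target: "\<exists>j\<ge>r. c j = C n \<and> v j = w" if w: "w \<in> V" for n r w
  proof -
    obtain i where i: "from_nat_into V i = w"
      using from_nat_into_surj[OF countable_finite[OF V(1)] w] by blast
    have "r \<le> prod_encode (n, prod_encode (i, r))"
      using le_prod_encode_2 order_trans by blast
    then show ?thesis
      by (intro exI[of _ "prod_encode (n, prod_encode (i, r))"]) (simp add: c_def v_def i)
  qed
  obtain h :: "nat \<Rightarrow> 'a \<Rightarrow> 'v" and K :: "nat \<Rightarrow> 'g set"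
    where h: "\<And>j. height V (h j)" and finK: "\<And>j. finite (K j)" and incK: "incseq K"
      and Kj: "\<And>j. from_nat j \<in> K (Suc j)"
      and mat: "\<And>j. matched (h (Suc j)) (c j) (v j) (K (Suc j))"
      and small: "\<And>j g. g \<in> K j \<Longrightarrow>
        prob {x \<in> space M. h (Suc j) (T g x) - h (Suc j) x \<noteq> h j (T g x) - h j x}
          \<le> (1/2) ^ j / (real (card (K j)) + 1)"
    by (rule height_sequence[OF V(2,3) vV cM]) (assumption, rule that)
  have hm [measurable]: "h j \<in> borel_measurable M" for j
    by (rule height_measurable[OF h])
  define d where "d n j x = h j (T n x) - h j x" for n j x
  have dm [measurable]: "d n j \<in> borel_measurable M" for n j
    unfolding d_def by measurable
  \<comment> \<open>The default 0 lies in \<open>V\<close>, so the finite range and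
    \<open>F e x \<in> V\<close> for generators hold at every point, not only almost
    everywhere.\<close>
  define F where "F n x = (if Cauchy (\<lambda>j. d n j x) then lim (\<lambda>j. d n j x) else 0)" for n x
  have Fm [measurable]: "F n \<in> borel_measurable M" for n
    unfolding F_def by measurable
  define bad where "bad i = (\<Union>g\<in>K i. {x \<in> space M. d g (Suc i) x \<noteq> d g i x})" for i
  \<comment> \<open>As \<open>K\<close> increases, outside \<open>Bad J\<close> the increments along
    \<open>K J\<close> are frozen from stage \<open>J\<close> on.\<close>
  define Bad where "Bad J = (\<Union>i. bad (i + J))" for J
  have bad [measurable]: "bad i \<in> sets M" for i
    unfolding bad_def using finK by (intro sets.finite_UN) auto
  have Bad [measurable]: "Bad J \<in> sets M" for J
    unfolding Bad_def by measurable
  have prob_bad: "prob (bad i) \<le> (1/2) ^ i" for i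
  proof -
    have "prob (bad i) \<le> (\<Sum>g\<in>K i. prob {x \<in> space M. d g (Suc i) x \<noteq> d g i x})"
      unfolding bad_def using finK by (intro measure_UNION_le) auto
    also have "\<dots> \<le> real (card (K i)) * ((1/2) ^ i / (real (card (K i)) + 1))"
      by (rule sum_bounded_above) (use small in \<open>simp add: d_def\<close>)
    also have "\<dots> \<le> (real (card (K i)) + 1) * ((1/2) ^ i / (real (card (K i)) + 1))"
      by (intro mult_right_mono) auto
    also have "\<dots> = (1/2) ^ i"
    proof -
      have "real (card (K i)) + 1 > 0" by simp
      then show ?thesis by (simp add: divide_simps)
    qed
    finally show ?thesis .
  qed
  have prob_Bad: "prob (Bad J) \<le> 2 * (1/2) ^ J" for J
  proof -
    have sums: "(\<lambda>i. (1/2) ^ (i + J)) sums (2 * (1/2) ^ J :: real)"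
      using sums_mult2[OF geometric_sums[of "1/2 :: real"], of "(1/2) ^ J"] by (simp add: power_add)
    have summable: "summable (\<lambda>i. prob (bad (i + J)))"
      by (rule summable_comparison_test'[OF sums_summable[OF sums], of 0]) (use prob_bad in simp)
    have "prob (Bad J) \<le> (\<Sum>i. prob (bad (i + J)))"
      unfolding Bad_def using summable by (intro finite_measure_subadditive_countably) auto
    also have "\<dots> \<le> (\<Sum>i. (1/2) ^ (i + J))"
      using prob_bad by (intro suminf_le summable sums_summable[OF sums]) auto
    also have "\<dots> = 2 * (1/2) ^ J" using sums by (rule sums_unique[symmetric])
    finally show ?thesis .
  qed
  have Bad_anti: "Bad J' \<subseteq> Bad J" if "J \<le> J'" for J J'
  proof
    fix x assume "x \<in> Bad J'"
    then obtain i where "x \<in> bad (i + J')" by (auto simp: Bad_def)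
    then have "x \<in> bad ((i + (J' - J)) + J)" using that by simp
    then show "x \<in> Bad J" unfolding Bad_def by blast
  qed
  have stable: "d g i x = d g J x" if x: "x \<in> space M" "x \<notin> Bad J" and g: "g \<in> K J" and "J \<le> i" for g i J x
    using \<open>J \<le> i\<close>
  proof (induction rule: dec_induct)
    case (step i)
    have "bad i \<subseteq> Bad J" using step(1) by (auto simp: Bad_def intro!: exI[of _ "i - J"])
    then have "x \<notin> bad i" using x by auto
    moreover have "g \<in> K i" using g incseqD[OF incK step(1)] by auto
    ultimately show ?case using x(1) step.IH by (auto simp: bad_def)
  qed simp
  have F_eq: "F g x = d g i x" if x: "x \<in> space M" "x \<notin> Bad J" and g: "g \<in> K J" and "J \<le> i" for g i J x
  proof -
    have "eventually (\<lambda>i. d g i x = d g J x) sequentially"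
      by (rule eventually_sequentiallyI[of J]) (rule stable[OF x g])
    then have lim: "(\<lambda>i. d g i x) \<longlonglongrightarrow> d g J x"
      by (rule tendsto_eventually)
    then have "Cauchy (\<lambda>i. d g i x)" by (rule LIMSEQ_imp_Cauchy)
    then show ?thesis
      using limI[OF lim] stable[OF x g \<open>J \<le> i\<close>] by (simp add: F_def)
  qed
  have "AE x in M. \<exists>J. x \<notin> Bad J"
  proof -
    have "prob (\<Inter>J. Bad J) \<le> 2 * (1/2) ^ J" for J
      by (rule order_trans[OF finite_measure_mono prob_Bad]) auto
    moreover have "(\<lambda>J. 2 * (1/2) ^ J :: real) \<longlonglongrightarrow> 2 * 0"
      by (intro tendsto_intros) auto
    ultimately have "prob (\<Inter>J. Bad J) \<le> 0"
      by (intro LIMSEQ_le_const[of "\<lambda>J. 2 * (1/2) ^ J :: real"]) auto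
    then have "prob (\<Inter>J. Bad J) = 0"
      using measure_nonneg[of M "\<Inter>J. Bad J"] by linarith
    then have "AE x in M. x \<notin> (\<Inter>J. Bad J)"
      by (intro AE_not_in null_setsI) (simp_all add: emeasure_eq_measure)
    then show ?thesis by simp
  qed
  note good = this AE_T[OF this]
  have W: "\<exists>W. finite W \<and> W \<subseteq> group_closure V \<and> (\<forall>j. \<forall>x\<in>space M. d n j x \<in> W)" for n
  proof -
    have "n \<in> group_closure E" by (simp add: gen)
    have "\<exists>W. finite W \<and> W \<subseteq> group_closure V \<and>
        (\<forall>h. height V h \<longrightarrow> (\<forall>x\<in>space M. h (T n x) - h x \<in> W))"
      by (rule height_increments[OF V \<open>n \<in> group_closure E\<close>])
    then obtain W where "finite W" "W \<subseteq> group_closure V"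
      "\<forall>h. height V h \<longrightarrow> (\<forall>x\<in>space M. h (T n x) - h x \<in> W)" by (elim exE conjE)
    then show ?thesis using h unfolding d_def by (intro exI[of _ W]) simp
  qed
  have F_in: "F n x \<in> insert 0 W" if "finite W" "\<And>j. d n j x \<in> W" for n x W
  proof (cases "Cauchy (\<lambda>j. d n j x)")
    case True
    then have "(\<lambda>j. d n j x) \<longlonglongrightarrow> F n x"
      by (simp add: F_def Cauchy_convergent_iff convergent_LIMSEQ_iff)
    then have "F n x \<in> W"
      by (rule closed_sequentially[OF finite_imp_closed[OF that(1)], rotated]) (rule that(2))
    then show ?thesis by simp
  qed (simp add: F_def)
  show thesis
  proof (rule that[of F])
    fix n
    from W[of n] obtain W where W: "finite W" "W \<subseteq> group_closure V"
      "\<forall>j. \<forall>x\<in>space M. d n j x \<in> W" by (elim exE conjE)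
    have "F n ` space M \<subseteq> insert 0 W"
    proof (intro image_subsetI)
      show "F n x \<in> insert 0 W" if "x \<in> space M" for x
        using W(3) that by (intro F_in[OF W(1)]) simp
    qed
    then show "finite (F n ` space M)" "F n ` space M \<subseteq> group_closure V"
      using W(1,2) by (auto intro: finite_subset)
  next
    fix n x assume "n \<in> E" "x \<in> space M"
    then have "F n x \<in> insert 0 V"
      using height_generator[OF h V(2,3)] by (intro F_in V) (auto simp: d_def)
    then show "F n x \<in> V" using V by auto
  next
    fix n k
    show "AE x in M. F (n + k) x = F k x + F n (T k x)"
      using good(1) good(2)[of k] AE_space
    proof eventually_elim
      case (elim x)
      then obtain J J' where J: "x \<notin> Bad J" "T k x \<notin> Bad J'" by blast
      \<comment> \<open>A stage so late that all three elements lie in \<open>K i\<close> and both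
        points avoid \<open>Bad i\<close>. There \<open>F\<close> agrees with a coboundary, for
        which the identity is exact.\<close>
      define i where "i = Max {J, J', Suc (to_nat n), Suc (to_nat k), Suc (to_nat (n + k))}"
      have i: "J \<le> i" "J' \<le> i" "Suc (to_nat n) \<le> i" "Suc (to_nat k) \<le> i" "Suc (to_nat (n + k)) \<le> i"
        unfolding i_def by (rule Max_ge; simp)+
      have nb: "x \<notin> Bad i" "T k x \<notin> Bad i"
        using J Bad_anti[OF i(1)] Bad_anti[OF i(2)] by auto
      have K: "n \<in> K i" "k \<in> K i" "n + k \<in> K i"
        using Kj[of "to_nat n"] Kj[of "to_nat k"] Kj[of "to_nat (n + k)"]
          incseqD[OF incK i(3)] incseqD[OF incK i(4)] incseqD[OF incK i(5)] by auto
      have "F (n + k) x = d (n + k) i x" "F k x = d k i x" "F n (T k x) = d n i (T k x)"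
        using elim nb K by (auto intro!: F_eq)
      then show ?case using elim by (simp add: d_def T_add)
    qed
  next
    fix A w assume A [measurable]: "A \<in> sets M" and A0: "0 < prob A" and w: "w \<in> V"
    \<comment> \<open>Three errors below \<open>a\<close> (twice \<open>C n - A\<close>, once
      \<open>Bad\<close>) become \<open>96 * a\<close> through the matched proportion 1/32, and
      replacing \<open>C n\<close> by \<open>A\<close> costs another \<open>a\<close>;
      \<open>97 * a\<close> is still less than \<open>prob A\<close>.\<close>
    define a where "a = prob A / 200"
    have a: "a > 0" using A0 by (simp add: a_def)
    obtain n where n: "prob (sym_diff A (C n)) < a" using dense[OF A a] by blast
    obtain r where "(1/2) ^ r < a / 2"
      using real_arch_pow_inv[of "a / 2" "1/2"] a by auto
    then have r: "2 * (1/2) ^ r < a" by simp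
    \<comment> \<open>The matching made at stage \<open>j\<close> survives off
      \<open>Bad (Suc j)\<close>, which must be small compared with \<open>A\<close>; hence the need
      for late recurrences.\<close>
    obtain j where j: "j \<ge> r" "c j = C n" "v j = w" using target[OF w] by blast
    have "(1/2) ^ Suc j \<le> ((1/2) ^ r :: real)"
      using j by (intro power_decreasing) auto
    then have BadJ: "prob (Bad (Suc j)) < a" using prob_Bad[of "Suc j"] r by linarith
    obtain I :: "(nat \<times> nat) set" and X Y where "finite I"
      and I: "\<forall>i\<in>I. from_nat (snd i) \<in> K (Suc j) \<and> X i \<in> sets M \<and> Y i \<in> sets M \<and>
        X i \<subseteq> C n \<and> Y i \<subseteq> C n \<and>
        (\<forall>x\<in>X i. T (from_nat (snd i)) x \<in> Y i \<and> h (Suc j) (T (from_nat (snd i)) x) - h (Suc j) x = w)"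
      and disj: "disjoint_family_on X I" "disjoint_family_on Y I"
      and mass: "prob (C n) / 32 \<le> (\<Sum>i\<in>I. prob (X i))"
      using mat[of j] unfolding matched_def j by (elim exE conjE)
    have disjoint_sum: "(\<Sum>i\<in>I. prob (Z i)) \<le> prob Q"
      if "\<And>i. i \<in> I \<Longrightarrow> Z i \<in> sets M" "\<And>i. i \<in> I \<Longrightarrow> Z i \<subseteq> Q" "Q \<in> sets M" "disjoint_family_on Z I" for Z Q
    proof -
      have "(\<Sum>i\<in>I. prob (Z i)) = prob (\<Union>i\<in>I. Z i)"
        using that \<open>finite I\<close> by (intro finite_measure_finite_Union[symmetric]) auto
      also have "\<dots> \<le> prob Q" using that(2,3) by (intro finite_measure_mono UN_least)
      finally show ?thesis .
    qed
    have disj_sub: "disjoint_family_on (\<lambda>i. Z i \<inter> Q) I" if "disjoint_family_on Z I" for Z :: "nat \<times> nat \<Rightarrow> 'a set" and Q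
      by (rule disjoint_family_on_bisimulation[OF that]) auto
    show "\<exists>g. 0 < prob {x \<in> space M. x \<in> A \<and> T g x \<in> A \<and> F g x = w}"
    proof (rule ccontr)
      assume "\<not> ?thesis"
      then have null: "prob {x \<in> space M. x \<in> A \<and> T g x \<in> A \<and> F g x = w} = 0" for g
        by (auto simp: zero_less_measure_iff)
      have "prob (X i) \<le> prob (X i \<inter> (C n - A)) + prob (Y i \<inter> (C n - A)) + prob (X i \<inter> Bad (Suc j))"
        if i: "i \<in> I" for i
      proof -
        define g where "g = (from_nat (snd i) :: 'g)"
        have [measurable]: "X i \<in> sets M" "Y i \<in> sets M" using I i by auto
        have Xs: "X i \<subseteq> space M" by (rule sets.sets_into_space) measurable
        have union4: "prob (((P1 \<union> P2) \<union> P3) \<union> P4) \<le> prob P1 + prob P2 + prob P3 + prob P4"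
          if "P1 \<in> sets M" "P2 \<in> sets M" "P3 \<in> sets M" "P4 \<in> sets M" for P1 P2 P3 P4
          using measure_Un_le[of "(P1 \<union> P2) \<union> P3" M P4] measure_Un_le[of "P1 \<union> P2" M P3]
            measure_Un_le[of P1 M P2] that by auto
        have "prob (X i) \<le> prob ((({x \<in> space M. x \<in> A \<and> T g x \<in> A \<and> F g x = w} \<union> (X i \<inter> (C n - A))) \<union>
            {x \<in> space M. T g x \<in> Y i \<inter> (C n - A)}) \<union> (X i \<inter> Bad (Suc j)))"
        proof (intro finite_measure_mono subsetI)
          fix x assume x: "x \<in> X i"
          then have xs: "x \<in> space M" using Xs by auto
          have gx: "g \<in> K (Suc j)" "T g x \<in> Y i" "d g (Suc j) x = w" "x \<in> C n" "T g x \<in> C n"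
            using I i x unfolding g_def d_def by auto
          have "F g x = w" if "x \<notin> Bad (Suc j)"
            using F_eq[OF xs that gx(1), of "Suc j"] gx(3) by simp
          then show "x \<in> (({x \<in> space M. x \<in> A \<and> T g x \<in> A \<and> F g x = w} \<union> (X i \<inter> (C n - A))) \<union>
            {x \<in> space M. T g x \<in> Y i \<inter> (C n - A)}) \<union> (X i \<inter> Bad (Suc j))"
            using x xs gx by blast
        qed measurable
        also have "\<dots> \<le> prob {x \<in> space M. x \<in> A \<and> T g x \<in> A \<and> F g x = w} + prob (X i \<inter> (C n - A)) +
            prob {x \<in> space M. T g x \<in> Y i \<inter> (C n - A)} + prob (X i \<inter> Bad (Suc j))"
          by (rule union4) measurable
        finally show ?thesis
          using null[of g] measure_T_vimage[of "Y i \<inter> (C n - A)" g] by simp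
      qed
      then have "(\<Sum>i\<in>I. prob (X i)) \<le> (\<Sum>i\<in>I. prob (X i \<inter> (C n - A)) +
          prob (Y i \<inter> (C n - A)) + prob (X i \<inter> Bad (Suc j)))"
        by (rule sum_mono)
      also have "\<dots> = (\<Sum>i\<in>I. prob (X i \<inter> (C n - A))) + (\<Sum>i\<in>I. prob (Y i \<inter> (C n - A))) +
          (\<Sum>i\<in>I. prob (X i \<inter> Bad (Suc j)))"
        by (simp add: sum.distrib)
      also have "\<dots> \<le> prob (C n - A) + prob (C n - A) + prob (Bad (Suc j))"
        using I disj by (intro add_mono disjoint_sum disj_sub) auto
      also have "\<dots> \<le> a + a + a"
      proof -
        have "prob (C n - A) \<le> prob (sym_diff A (C n))"
          by (intro finite_measure_mono) auto
        then show ?thesis using n BadJ by linarith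
      qed
      finally have "prob (C n) \<le> 96 * a" using mass by linarith
      moreover have "prob A \<le> prob (C n) + prob (sym_diff A (C n))"
      proof -
        have "prob A \<le> prob (C n \<union> sym_diff A (C n))" by (intro finite_measure_mono) auto
        also have "\<dots> \<le> prob (C n) + prob (sym_diff A (C n))" by (intro measure_Un_le) auto
        finally show ?thesis .
      qed
      ultimately show False using n a unfolding a_def by linarith
    qed
  qed measurable
qed

end

section \<open>Translations by a dense subgroup\<close>

locale haar_space =
  fixes G :: "'v::euclidean_space set" and \<mu> :: "'v measure"
  assumes closed_G: "closed G" and subgroup: "additive_subgroup G" and haar: "haar_measure_on G \<mu>"
begin

lemma G_add: "x \<in> G \<Longrightarrow> y \<in> G \<Longrightarrow> x + y \<in> G" and G_minus: "x \<in> G \<Longrightarrow> - x \<in> G"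
  using subgroup by (auto simp: additive_subgroup_def)

lemma sets_haar: "sets \<mu> = sets (restrict_space borel G)"
  using haar by (simp add: haar_measure_on_def)

lemma space_haar [simp]: "space \<mu> = G"
  using sets_eq_imp_space_eq[OF sets_haar] by (simp add: space_restrict_space)

lemma in_sets_haar: "A \<in> sets \<mu> \<longleftrightarrow> A \<in> sets borel \<and> A \<subseteq> G"
  unfolding sets_haar using closed_G by (subst sets_restrict_space_iff) auto

lemma measurable_ident_haar [measurable]: "(\<lambda>z. z) \<in> \<mu> \<rightarrow>\<^sub>M borel"
  by (subst measurable_cong_sets[OF sets_haar refl]) (rule measurable_restrict_space1, simp)

lemma measurable_into_haar:
  assumes "f \<in> borel_measurable N" "\<And>x. x \<in> space N \<Longrightarrow> f x \<in> G"
  shows "f \<in> N \<rightarrow>\<^sub>M \<mu>"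
  by (subst measurable_cong_sets[OF refl sets_haar]) (rule measurable_restrict_space2, use assms in auto)

lemma translate_measurable [measurable]: "g \<in> G \<Longrightarrow> (\<lambda>z. z + g) \<in> \<mu> \<rightarrow>\<^sub>M \<mu>"
  by (rule measurable_into_haar) (auto intro: G_add)

lemma translate_sets [measurable]:
  assumes "g \<in> G" "A \<in> sets \<mu>"
  shows "{z \<in> G. z + g \<in> A} \<in> sets \<mu>"
proof -
  have "(\<lambda>z. z + g) -` A \<inter> space \<mu> \<in> sets \<mu>"
    using assms by (intro measurable_sets[OF translate_measurable])
  then show ?thesis by (simp add: vimage_def Int_def conj_commute)
qed

lemma emeasure_translate:
  assumes "g \<in> G" "A \<in> sets \<mu>"
  shows "emeasure \<mu> {z \<in> G. z + g \<in> A} = emeasure \<mu> A"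
proof -
  have "{z \<in> G. z + g \<in> A} = (\<lambda>z. - g + z) ` A"
    using assms in_sets_haar[of A] G_add[OF _ G_minus[OF assms(1)]]
    by (auto simp: image_iff algebra_simps)
  moreover have "emeasure \<mu> ((\<lambda>z. - g + z) ` A) = emeasure \<mu> A"
    using haar assms G_minus[OF assms(1)] unfolding haar_measure_on_def by blast
  ultimately show ?thesis by simp
qed

lemma emeasure_compact: "compact K \<Longrightarrow> K \<subseteq> G \<Longrightarrow> emeasure \<mu> K < \<infinity>"
  using haar by (simp add: haar_measure_on_def)

lemma compact_in_sets: "compact K \<Longrightarrow> K \<subseteq> G \<Longrightarrow> K \<in> sets \<mu>"
  by (simp add: in_sets_haar compact_imp_closed)

lemma compact_cball: "compact (G \<inter> cball 0 r)"
  by (intro closed_Int_compact closed_G compact_cball)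

lemma cover: "(\<Union>n. G \<inter> cball 0 (real n)) = G"
  using real_arch_simple by (auto simp: dist_norm)

lemma sigma_finite_haar: "sigma_finite_measure \<mu>"
proof
  show "\<exists>A. countable A \<and> A \<subseteq> sets \<mu> \<and> \<Union>A = space \<mu> \<and> (\<forall>a\<in>A. emeasure \<mu> a \<noteq> \<infinity>)"
    using cover compact_cball emeasure_compact compact_in_sets
    by (intro exI[of _ "range (\<lambda>n. G \<inter> cball 0 (real n))"]) (auto simp: less_top[symmetric])
qed

lemma AE_translate:
  assumes "AE z in \<mu>. P z" and g: "g \<in> G"
  shows "AE z in \<mu>. P (z + g)"
proof -
  obtain N where N: "N \<in> null_sets \<mu>" "{z \<in> space \<mu>. \<not> P z} \<subseteq> N"
    using assms by (auto simp: eventually_ae_filter)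
  have "{z \<in> G. z + g \<in> N} \<in> sets \<mu>"
    using N(1) g by (intro translate_sets) auto
  then have "{z \<in> G. z + g \<in> N} \<in> null_sets \<mu>"
    using emeasure_translate[OF g, of N] N(1) by (auto simp: null_sets_def)
  then show ?thesis
    by (rule AE_I') (use N(2) G_add g in auto)
qed

text \<open>Inner regularity is applied to a finite Borel measure on the whole space:
  \<open>\<mu>\<close> restricted to a ball in which \<open>A\<close> keeps positive measure, pushed
  forward along the inclusion of \<open>G\<close>.\<close>

lemma compact_subset_positive:
  assumes A: "A \<in> sets \<mu>" "emeasure \<mu> A > 0"
  obtains K where "compact K" "K \<subseteq> A" "emeasure \<mu> K > 0"
proof -
  have "\<exists>n. emeasure \<mu> (A \<inter> cball 0 (real n)) > 0"
  proof (rule ccontr)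
    assume "\<not> ?thesis"
    then have "A \<inter> cball 0 (real n) \<in> null_sets \<mu>" for n
      using A by (auto simp: null_sets_def in_sets_haar not_less)
    then have "(\<Union>n. A \<inter> cball 0 (real n)) \<in> null_sets \<mu>"
      by (intro null_sets_UN) 
    also have "(\<Union>n. A \<inter> cball 0 (real n)) = A"
      using cover A in_sets_haar[of A] by blast
    finally show False using A by auto
  qed
  then obtain n where n: "emeasure \<mu> (A \<inter> cball 0 (real n)) > 0" by blast
  define C where "C = cball (0 :: 'v) (real n)"
  have C: "C \<inter> G \<in> sets \<mu>" by (simp add: C_def in_sets_haar closed_G)
  define N where "N = distr (density \<mu> (indicator (C \<inter> G))) borel (\<lambda>z. z)"
  have N: "emeasure N B = emeasure \<mu> (C \<inter> G \<inter> B)" if B: "B \<in> sets borel" for B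
  proof -
    have "G \<inter> B \<in> sets \<mu>" using B by (simp add: in_sets_haar closed_G)
    have "emeasure N B = emeasure (density \<mu> (indicator (C \<inter> G))) (G \<inter> B)"
      unfolding N_def using B by (subst emeasure_distr) (auto simp: Int_commute)
    also have "\<dots> = emeasure \<mu> (C \<inter> G \<inter> (G \<inter> B))"
      using C \<open>G \<inter> B \<in> sets \<mu>\<close>
      by (subst emeasure_density) (auto simp: indicator_inter_arith[symmetric] nn_integral_indicator)
    also have "C \<inter> G \<inter> (G \<inter> B) = C \<inter> G \<inter> B" by auto
    finally show ?thesis .
  qed
  have "emeasure N A = (SUP K \<in> {K. K \<subseteq> A \<and> compact K}. emeasure N K)"
  proof (rule inner_regular)
    show "emeasure N (space N) \<noteq> \<infinity>"
      using N[of UNIV] emeasure_compact[OF compact_cball[of "real n"]]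
      by (simp add: N_def[THEN arg_cong[where f = space]] C_def Int_commute less_top[symmetric])
  qed (use A in \<open>auto simp: N_def in_sets_haar\<close>)
  moreover have "emeasure N A > 0"
  proof -
    have "C \<inter> G \<inter> A = A \<inter> C" using A in_sets_haar[of A] by auto
    then show ?thesis using n N[of A] A by (simp add: C_def in_sets_haar)
  qed
  ultimately obtain K where K: "K \<subseteq> A" "compact K" "emeasure N K > 0"
    by (auto simp: less_SUP_iff)
  then have "emeasure \<mu> (C \<inter> G \<inter> K) > 0" using N[of K] by (simp add: compact_imp_closed)
  moreover have "compact (C \<inter> G \<inter> K)"
    using K closed_G by (auto simp: C_def intro!: closed_Int_compact)
  ultimately show thesis using K by (intro that[of "C \<inter> G \<inter> K"]) auto
qed

text \<open>The measure \<open>A \<mapsto> \<mu> (B \<inter> A)\<close> is invariant under the dense subgroup, hence its compact null sets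
  stay null under every translation in \<open>G\<close>. Fubini then shows that \<open>B\<close> or its complement is null.\<close>

lemma dense_subgroup_ergodic:
  assumes \<Lambda>: "closure \<Lambda> = G" "\<And>l. l \<in> \<Lambda> \<Longrightarrow> - l \<in> \<Lambda>" and B: "B \<in> sets \<mu>"
    and inv: "\<And>l. l \<in> \<Lambda> \<Longrightarrow> AE z in \<mu>. z \<in> B \<longrightarrow> z + l \<in> B"
  shows "emeasure \<mu> B = 0 \<or> emeasure \<mu> (G - B) = 0"
proof (rule disjCI)
  assume "emeasure \<mu> (G - B) \<noteq> 0"
  then have pos: "emeasure \<mu> (G - B) > 0" by (simp add: zero_less_iff_neq_zero)
  have Bc: "G - B \<in> sets \<mu>" using B closed_G by (auto simp: in_sets_haar)
  obtain K where K: "compact K" "K \<subseteq> G - B" "emeasure \<mu> K > 0"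
    by (rule compact_subset_positive[OF Bc pos]) (rule that)
  have KG: "K \<subseteq> G" using K by auto
  have Ks [measurable]: "K \<in> sets \<mu>" using K KG by (intro compact_in_sets)
  have Kb [measurable]: "K \<in> sets borel" using K by (simp add: compact_imp_closed)
  have Kne: "K \<noteq> {}" using K by auto
  \<comment> \<open>Neighbourhoods of \<open>K\<close> in \<open>G\<close> of finite measure that
    shrink to \<open>K\<close>. As \<open>K\<close> misses \<open>B\<close>, the measure of
    \<open>B \<inter> U n\<close> tends to 0.\<close>
  define U where "U n = {z \<in> G. infdist z K \<le> 1 / real (Suc n)}" for n
  have U_cl: "closed (U n)" for n
  proof -
    have "closed {z. infdist z K \<le> 1 / real (Suc n)}"
      by (intro closed_Collect_le continuous_intros)
    moreover have "U n = G \<inter> {z. infdist z K \<le> 1 / real (Suc n)}" by (auto simp: U_def)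
    ultimately show ?thesis using closed_G by auto
  qed
  have Us [measurable]: "U n \<in> sets \<mu>" for n
    using U_cl[of n] by (auto simp: in_sets_haar U_def)
  have "bounded (U 0)"
  proof -
    obtain r where r: "\<And>z. z \<in> K \<Longrightarrow> norm z \<le> r"
      using compact_imp_bounded[OF K(1)] by (auto simp: bounded_iff)
    have "norm z \<le> 1 + r" if "z \<in> U 0" for z
    proof -
      obtain k where k: "k \<in> K" "infdist z K = dist z k"
        using infdist_attains_inf[OF compact_imp_closed[OF K(1)] Kne] by blast
      then have "norm (z - k) \<le> 1" using that by (simp add: U_def dist_norm)
      then show ?thesis using r[OF k(1)] norm_triangle_sub[of z k] by linarith
    qed
    then show ?thesis by (auto simp: bounded_iff)
  qed
  then have U0: "emeasure \<mu> (U 0) < \<infinity>"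
    using U_cl[of 0] by (intro emeasure_compact) (auto simp: compact_eq_bounded_closed U_def)
  have Ufin: "emeasure \<mu> (B \<inter> U n) \<noteq> \<infinity>" for n
  proof -
    have "1 / real (Suc n) \<le> 1 / real (Suc 0)" by simp
    then have "U n \<subseteq> U 0" unfolding U_def by (auto simp del: of_nat_Suc elim: order_trans)
    then have "emeasure \<mu> (B \<inter> U n) \<le> emeasure \<mu> (U 0)" by (intro emeasure_mono) auto
    then show ?thesis using U0 by (auto simp: less_top[symmetric] top_unique)
  qed
  have "(\<lambda>n. emeasure \<mu> (B \<inter> U n)) \<longlonglongrightarrow> emeasure \<mu> (\<Inter>n. B \<inter> U n)"
  proof (rule Lim_emeasure_decseq)
    show "decseq (\<lambda>n. B \<inter> U n)"
    proof (intro decseq_SucI)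
      fix n
      have "1 / real (Suc (Suc n)) \<le> 1 / real (Suc n)" by (simp add: divide_simps)
      then show "B \<inter> U (Suc n) \<subseteq> B \<inter> U n" by (auto simp: U_def)
    qed
  qed (use B Ufin in auto)
  moreover have "(\<Inter>n. B \<inter> U n) = {}"
  proof (rule ccontr)
    assume "(\<Inter>n. B \<inter> U n) \<noteq> {}"
    then obtain z where z: "\<And>n. z \<in> B" "\<And>n. infdist z K \<le> 1 / real (Suc n)" by (auto simp: U_def)
    have "(\<lambda>n. 1 / real (Suc n)) \<longlonglongrightarrow> 0"
      by (rule LIMSEQ_Suc[OF lim_1_over_n])
    then have "infdist z K \<le> 0" using z(2) by (intro LIMSEQ_le_const) auto
    then have "infdist z K = 0" using infdist_nonneg[of z K] by linarith
    then have "z \<in> K" using K Kne by (simp add: in_closed_iff_infdist_zero compact_imp_closed)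
    then show False using z(1) K(2) by auto
  qed
  ultimately have lim: "(\<lambda>n. emeasure \<mu> (B \<inter> U n)) \<longlonglongrightarrow> 0" by simp
  \<comment> \<open>Replace \<open>g\<close> by a nearby \<open>l \<in> \<Lambda>\<close>: if
    \<open>z + g \<in> K\<close> then \<open>z + l \<in> U n\<close>, and almost every
    \<open>z \<in> B\<close> has \<open>z + l \<in> B\<close>. So the set has at most the measure of
    \<open>B \<inter> U n\<close>.\<close>
  have null: "emeasure \<mu> {z \<in> G. z \<in> B \<and> z + g \<in> K} = 0" if g: "g \<in> G" for g
  proof -
    have "emeasure \<mu> {z \<in> G. z \<in> B \<and> z + g \<in> K} \<le> emeasure \<mu> (B \<inter> U n)" for n
    proof -
      have "g \<in> closure \<Lambda>" using g \<Lambda> by simp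
      then obtain l where l: "l \<in> \<Lambda>" "dist l g < 1 / real (Suc n)"
        unfolding closure_approachable by (metis of_nat_0_less_iff zero_less_Suc zero_less_divide_1_iff)
      have lG: "l \<in> G" using l \<Lambda> closure_subset[of \<Lambda>] by auto
      have sub: "z + l \<in> U n" if "z \<in> G" "z + g \<in> K" for z
      proof -
        have "infdist (z + l) K \<le> dist (z + l) (z + g)" using that by (intro infdist_le)
        also have "\<dots> = dist l g" by simp
        finally show ?thesis using l that lG by (auto simp: U_def intro: G_add)
      qed
      have "emeasure \<mu> {z \<in> G. z \<in> B \<and> z + g \<in> K} \<le> emeasure \<mu> {z \<in> G. z + l \<in> B \<inter> U n}"
      proof (rule emeasure_mono_AE)
        show "AE z in \<mu>. z \<in> {z \<in> G. z \<in> B \<and> z + g \<in> K} \<longrightarrow> z \<in> {z \<in> G. z + l \<in> B \<inter> U n}"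
          using inv[OF l(1)] by eventually_elim (use sub in auto)
        show "{z \<in> G. z + l \<in> B \<inter> U n} \<in> sets \<mu>"
          using B lG by (intro translate_sets) auto
      qed
      also have "\<dots> = emeasure \<mu> (B \<inter> U n)"
        using B by (intro emeasure_translate lG) auto
      finally show ?thesis .
    qed
    then have "emeasure \<mu> {z \<in> G. z \<in> B \<and> z + g \<in> K} \<le> 0"
      using lim by (intro LIMSEQ_le_const) auto
    then show ?thesis by simp
  qed
  interpret sigma_finite_measure \<mu> by (rule sigma_finite_haar)
  interpret pair_sigma_finite \<mu> \<mu> ..
  have [measurable]: "B \<in> sets \<mu>" by (rule B)
  \<comment> \<open>The pairs \<open>(z, g)\<close> with \<open>z \<in> B\<close> and
    \<open>z + g \<in> K\<close> are measured twice: integrating over \<open>g\<close> first gives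
    the product, by invariance, and integrating over \<open>z\<close> first gives 0, by
    \<open>null\<close>.\<close>
  have "emeasure \<mu> K * emeasure \<mu> B = (\<integral>\<^sup>+z. emeasure \<mu> K * indicator B z \<partial>\<mu>)"
    by (rule nn_integral_cmult_indicator[symmetric]) (rule B)
  also have "\<dots> = (\<integral>\<^sup>+z. \<integral>\<^sup>+g. indicator B z * indicator K (z + g) \<partial>\<mu> \<partial>\<mu>)"
  proof (intro nn_integral_cong)
    fix z assume "z \<in> space \<mu>"
    then have z: "z \<in> G" by simp
    have "(\<integral>\<^sup>+g. indicator K (z + g) \<partial>\<mu>) = (\<integral>\<^sup>+g. indicator {g \<in> G. g + z \<in> K} g \<partial>\<mu>)"
      by (intro nn_integral_cong) (auto simp: indicator_def add.commute)
    also have "\<dots> = emeasure \<mu> {g \<in> G. g + z \<in> K}"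
      using z by (intro nn_integral_indicator translate_sets) auto
    also have "\<dots> = emeasure \<mu> K" using z by (intro emeasure_translate) auto
    finally have "(\<integral>\<^sup>+g. indicator K (z + g) \<partial>\<mu>) = emeasure \<mu> K" .
    then show "emeasure \<mu> K * indicator B z = (\<integral>\<^sup>+g. indicator B z * indicator K (z + g) \<partial>\<mu>)"
      by (subst nn_integral_cmult) (auto simp: mult.commute)
  qed
  also have "\<dots> = (\<integral>\<^sup>+g. \<integral>\<^sup>+z. indicator B z * indicator K (z + g) \<partial>\<mu> \<partial>\<mu>)"
    by (rule Fubini') measurable
  also have "\<dots> = (\<integral>\<^sup>+g. 0 \<partial>\<mu>)"
  proof (intro nn_integral_cong)
    fix g assume "g \<in> space \<mu>"
    then have g: "g \<in> G" by simp
    have "(\<integral>\<^sup>+z. indicator B z * indicator K (z + g) \<partial>\<mu>) =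
        (\<integral>\<^sup>+z. indicator {z \<in> G. z \<in> B \<and> z + g \<in> K} z \<partial>\<mu>)"
      by (intro nn_integral_cong) (auto simp: indicator_def)
    also have "\<dots> = emeasure \<mu> {z \<in> G. z \<in> B \<and> z + g \<in> K}"
    proof (rule nn_integral_indicator)
      have "{z \<in> G. z \<in> B \<and> z + g \<in> K} = B \<inter> {z \<in> G. z + g \<in> K}"
        using in_sets_haar[of B] B by auto
      moreover have "{z \<in> G. z + g \<in> K} \<in> sets \<mu>"
        using g by (intro translate_sets) auto
      ultimately show "{z \<in> G. z \<in> B \<and> z + g \<in> K} \<in> sets \<mu>" using B by simp
    qed
    finally show "(\<integral>\<^sup>+z. indicator B z * indicator K (z + g) \<partial>\<mu>) = 0" using null[OF g] by simp
  qed
  finally show "emeasure \<mu> B = 0" using K(3) by auto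
qed

end

section \<open>Ergodicity of the skew product\<close>

text \<open>Suppose \<open>(x, z) \<in> E\<close> and \<open>(x, z + s) \<notin> E\<close> for a set
  of \<open>x\<close> of positive measure. A return to this set with cocycle value exactly
  \<open>s\<close> carries \<open>(x, z)\<close> to \<open>(T g x, z + s)\<close>, which is in
  \<open>E\<close> by invariance and outside it by the choice of the set.\<close>

lemma ergodic_skew_product:
  fixes S :: "'v::euclidean_space set"
  assumes "pmp_action M T" and "haar_space G \<mu>"
    and F: "\<And>n. F n \<in> borel_measurable M" and FG: "\<And>n x. x \<in> space M \<Longrightarrow> F n x \<in> G"
    and fin: "finite S" and sym: "\<And>s. s \<in> S \<Longrightarrow> - s \<in> S" and dense: "closure (group_closure S) = G"
    and essential: "\<And>A s. A \<in> sets M \<Longrightarrow> 0 < measure M A \<Longrightarrow> s \<in> S \<Longrightarrow>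
       \<exists>g. 0 < measure M {x \<in> space M. x \<in> A \<and> T g x \<in> A \<and> F g x = s}"
  shows "ergodic_action (M \<Otimes>\<^sub>M \<mu>) (skew_product T F)"
  unfolding ergodic_action_def
proof (intro ballI impI)
  fix E assume E [measurable]: "E \<in> sets (M \<Otimes>\<^sub>M \<mu>)"
    and inv: "\<forall>n. AE p in M \<Otimes>\<^sub>M \<mu>. skew_product T F n p \<in> E \<longleftrightarrow> p \<in> E"
  interpret pmp_action M T by fact
  interpret haar_space G \<mu> by fact
  interpret H: sigma_finite_measure \<mu> by (rule sigma_finite_haar)
  interpret P: pair_sigma_finite M \<mu> ..
  note F [measurable]
  have \<Lambda>G: "l \<in> G" if "l \<in> group_closure S" for l
    using dense closure_subset[of "group_closure S"] that by auto
  have SG: "s \<in> G" if "s \<in> S" for s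
    using \<Lambda>G that by (auto intro: group_closure.base)
  have inv': "AE p in M \<Otimes>\<^sub>M \<mu>. \<forall>n. skew_product T F n p \<in> E \<longleftrightarrow> p \<in> E"
    using inv by (simp add: AE_all_countable)
  have skew: "AE x in M. AE z in \<mu>. \<forall>n. (T n x, z + F n x) \<in> E \<longleftrightarrow> (x, z) \<in> E"
    using P.AE_pair[OF inv'] by (simp add: skew_product_def)
  have Fz [measurable]: "(\<lambda>p. snd p + F n (fst p)) \<in> M \<Otimes>\<^sub>M \<mu> \<rightarrow>\<^sub>M \<mu>" for n
    by (rule measurable_into_haar) (auto simp: space_pair_measure intro!: G_add FG)
  \<comment> \<open>The essential value argument fixes \<open>z\<close> and varies \<open>x\<close>,
    the fibre argument fixes \<open>x\<close> and varies \<open>z\<close>; Fubini exchanges the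
    quantifiers.\<close>
  have skew': "AE z in \<mu>. AE x in M. \<forall>n. (T n x, z + F n x) \<in> E \<longleftrightarrow> (x, z) \<in> E"
  proof (rule P.AE_commute[THEN iffD1, OF _ skew])
    have "Measurable.pred (M \<Otimes>\<^sub>M \<mu>) (\<lambda>p. \<forall>n. (T n (fst p), snd p + F n (fst p)) \<in> E \<longleftrightarrow> p \<in> E)"
      by measurable
    then show "{p \<in> space (M \<Otimes>\<^sub>M \<mu>). \<forall>n. (T n (fst p), snd p + F n (fst p)) \<in> E \<longleftrightarrow>
        (fst p, snd p) \<in> E} \<in> sets (M \<Otimes>\<^sub>M \<mu>)"
      by (simp add: pred_def)
  qed
  have step: "AE x in M. AE z in \<mu>. (x, z) \<in> E \<longrightarrow> (x, z + s) \<in> E" if s: "s \<in> S" for s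
  proof -
    have tr [measurable]: "(\<lambda>p. snd p + s) \<in> M \<Otimes>\<^sub>M \<mu> \<rightarrow>\<^sub>M \<mu>"
      by (rule measurable_into_haar) (auto simp: space_pair_measure intro: G_add SG[OF s])
    have "AE z in \<mu>. AE x in M. (x, z) \<in> E \<longrightarrow> (x, z + s) \<in> E"
      using skew' AE_space
    proof eventually_elim
      case (elim z)
      then have z: "z \<in> space \<mu>" "z + s \<in> space \<mu>" using SG[OF s] by (auto intro: G_add)
      define A where "A = {x \<in> space M. (x, z) \<in> E \<and> (x, z + s) \<notin> E}"
      have A [measurable]: "A \<in> sets M"
      proof -
        have "A = ((\<lambda>x. (x, z)) -` E \<inter> space M) - ((\<lambda>x. (x, z + s)) -` E \<inter> space M)"
          by (auto simp: A_def)
        then show ?thesis using sets_Pair2[OF E] by (auto simp: measurable_sets[OF measurable_Pair2'] z E)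
      qed
      have "measure M A = 0"
      proof (rule ccontr)
        assume "measure M A \<noteq> 0"
        then have "0 < measure M A" by (simp add: zero_less_measure_iff)
        then obtain g where g: "0 < measure M {x \<in> space M. x \<in> A \<and> T g x \<in> A \<and> F g x = s}"
          using essential[OF A _ s] by blast
        have "AE x in M. \<not> (x \<in> A \<and> T g x \<in> A \<and> F g x = s)"
          using elim(1) by eventually_elim (auto simp: A_def)
        then have "measure M {x \<in> space M. x \<in> A \<and> T g x \<in> A \<and> F g x = s} = 0"
          by (subst prob_Collect_eq_0) simp_all
        then show False using g by simp
      qed
      then have "AE x in M. x \<notin> A"
        by (intro AE_not_in null_setsI) (simp_all add: emeasure_eq_measure)
      then show ?case using AE_space by eventually_elim (auto simp: A_def)
    qed
    then show ?thesis
    proof (rule P.AE_commute[THEN iffD2, rotated])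
      have "Measurable.pred (M \<Otimes>\<^sub>M \<mu>) (\<lambda>p. p \<in> E \<longrightarrow> (fst p, snd p + s) \<in> E)"
        by measurable
      then show "{p \<in> space (M \<Otimes>\<^sub>M \<mu>). (fst p, snd p) \<in> E \<longrightarrow> (fst p, snd p + s) \<in> E} \<in> sets (M \<Otimes>\<^sub>M \<mu>)"
        by (simp add: pred_def)
    qed
  qed
  have "AE x in M. \<forall>s\<in>S. AE z in \<mu>. (x, z) \<in> E \<longrightarrow> (x, z + s) \<in> E"
    using fin step by (intro AE_finite_allI)
  then have dich: "AE x in M. emeasure \<mu> (Pair x -` E) = 0 \<or> emeasure \<mu> (G - Pair x -` E) = 0"
    using AE_space
  proof eventually_elim
    case (elim x)
    have Ex: "Pair x -` E \<in> sets \<mu>" using E by (rule sets_Pair1)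
    \<comment> \<open>Both signs are carried along because \<open>group_closure\<close> is built
      from differences: \<open>a - b\<close> uses \<open>a\<close> and \<open>- b\<close>, its
      negative uses \<open>- a\<close> and \<open>b\<close>.\<close>
    have pm: "(AE z in \<mu>. (x, z) \<in> E \<longrightarrow> (x, z + l) \<in> E) \<and> (AE z in \<mu>. (x, z) \<in> E \<longrightarrow> (x, z + - l) \<in> E)"
      if "l \<in> group_closure S" for l
      using that
    proof induction
      case (base s)
      show ?case
      proof (cases "s = 0")
        case False
        then have "s \<in> S" using base by simp
        then show ?thesis using bspec[OF elim(1), of s] bspec[OF elim(1) sym, of s] by blast
      qed simp
    next
      case (diff a b)
      have comb: "AE z in \<mu>. (x, z) \<in> E \<longrightarrow> (x, z + (k + l)) \<in> E"
        if k: "k \<in> G" "AE z in \<mu>. (x, z) \<in> E \<longrightarrow> (x, z + k) \<in> E"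
          and l: "AE z in \<mu>. (x, z) \<in> E \<longrightarrow> (x, z + l) \<in> E" for k l
        using k(2) AE_translate[OF l k(1)] by eventually_elim (auto simp: add.assoc)
      have "a \<in> G" "- a \<in> G" using \<Lambda>G diff.hyps by (auto intro: G_minus)
      then show ?case
        using comb[of a "- b"] comb[of "- a" b] diff.IH by (simp add: algebra_simps)
    qed
    show ?case
      by (rule dense_subgroup_ergodic[OF dense _ Ex]) (use pm in auto)
  qed
  define A where "A = {x \<in> space M. emeasure \<mu> (Pair x -` E) \<noteq> 0}"
  have [measurable]: "(\<lambda>x. emeasure \<mu> (Pair x -` E)) \<in> borel_measurable M"
    by (rule P.measurable_emeasure_Pair1[OF E])
  have A [measurable]: "A \<in> sets M" unfolding A_def by measurable
  \<comment> \<open>The fibres of \<open>E\<close> over \<open>x\<close> and \<open>T n x\<close>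
    are translates of each other by \<open>F n x\<close>, up to a null set, so they are null
    together.\<close>
  have "AE x in M. T n x \<in> A \<longleftrightarrow> x \<in> A" for n
    using skew AE_space
  proof eventually_elim
    case (elim x)
    have "emeasure \<mu> (Pair x -` E) = emeasure \<mu> {z \<in> G. z + F n x \<in> Pair (T n x) -` E}"
    proof (rule emeasure_eq_AE)
      show "AE z in \<mu>. z \<in> Pair x -` E \<longleftrightarrow> z \<in> {z \<in> G. z + F n x \<in> Pair (T n x) -` E}"
        using elim(1) AE_space by eventually_elim auto
      show "{z \<in> G. z + F n x \<in> Pair (T n x) -` E} \<in> sets \<mu>"
        using FG[OF elim(2)] sets_Pair1[OF E] by (intro translate_sets)
    qed (rule sets_Pair1[OF E])
    also have "\<dots> = emeasure \<mu> (Pair (T n x) -` E)"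
      using FG[OF elim(2)] sets_Pair1[OF E] by (intro emeasure_translate)
    finally show ?case using elim(2) by (simp add: A_def)
  qed
  then consider "A \<in> null_sets M" | "space M - A \<in> null_sets M"
    using ergodic A unfolding ergodic_action_def by blast
  then show "E \<in> null_sets (M \<Otimes>\<^sub>M \<mu>) \<or> space (M \<Otimes>\<^sub>M \<mu>) - E \<in> null_sets (M \<Otimes>\<^sub>M \<mu>)"
  proof cases
    case 1
    have "AE x in M. emeasure \<mu> (Pair x -` E) = 0"
      using AE_not_in[OF 1] AE_space by eventually_elim (auto simp: A_def)
    then have "emeasure (M \<Otimes>\<^sub>M \<mu>) E = 0"
      by (subst H.emeasure_pair_measure_alt[OF E]) (simp add: nn_integral_0_iff_AE)
    then show ?thesis by auto
  next
    case 2
    have Ec: "space (M \<Otimes>\<^sub>M \<mu>) - E \<in> sets (M \<Otimes>\<^sub>M \<mu>)" by measurable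
    have "AE x in M. emeasure \<mu> (Pair x -` (space (M \<Otimes>\<^sub>M \<mu>) - E)) = 0"
      using AE_not_in[OF 2] AE_space dich
    proof eventually_elim
      case (elim x)
      then have "Pair x -` (space (M \<Otimes>\<^sub>M \<mu>) - E) = G - Pair x -` E"
        by (auto simp: space_pair_measure)
      then show ?case using elim by (auto simp: A_def)
    qed
    then have "emeasure (M \<Otimes>\<^sub>M \<mu>) (space (M \<Otimes>\<^sub>M \<mu>) - E) = 0"
      using P.measurable_emeasure_Pair1[OF Ec]
      by (subst H.emeasure_pair_measure_alt[OF Ec]) (simp add: nn_integral_0_iff_AE)
    then show ?thesis using Ec by auto
  qed
qed

text \<open>An almost everywhere action of a countable group is an action on an invariant conull set;
  off this set it is replaced by the trivial action.\<close>

lemma mp_action_pmp_action: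
  fixes T :: "'g::{ab_group_add, countable} \<Rightarrow> 'a \<Rightarrow> 'a"
  assumes "prob_space M" "mp_action M T" "ergodic_action M T"
  obtains T' where "pmp_action M T'" "\<And>n. AE x in M. T' n x = T n x"
proof -
  interpret prob_space M by fact
  have [measurable]: "T n \<in> M \<rightarrow>\<^sub>M M" and distr: "distr M M (T n) = M" for n
    using assms(2) by (auto simp: mp_action_def)
  have sp: "T n x \<in> space M" if "x \<in> space M" for n x
    using that by (rule measurable_space[rotated]) simp
  have "AE x in M. T 0 x = x \<and> (\<forall>n k. T (n + k) x = T n (T k x))"
    using assms(2) by (simp add: mp_action_def AE_all_countable)
  then obtain N where N: "N \<in> null_sets M"
    and sub: "{x \<in> space M. \<not> (T 0 x = x \<and> (\<forall>n k. T (n + k) x = T n (T k x)))} \<subseteq> N"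
    unfolding eventually_ae_filter by (elim bexE)
  have good: "T 0 x = x \<and> (\<forall>n k. T (n + k) x = T n (T k x))" if "x \<in> space M" "x \<notin> N" for x
    using sub that by blast
  have [measurable]: "N \<in> sets M" using N by auto
  define X where "X = {x \<in> space M. x \<notin> N \<and> (\<forall>n. T n x \<notin> N)}"
  have [measurable]: "X \<in> sets M" unfolding X_def by measurable
  have "AE x in M. T n x \<notin> N" for n
  proof -
    have "AE x in distr M M (T n). x \<notin> N" unfolding distr using N by (rule AE_not_in)
    then show ?thesis by (subst (asm) AE_distr_iff) auto
  qed
  then have "AE x in M. \<forall>n. T n x \<notin> N" by (simp add: AE_all_countable)
  then have AEX: "AE x in M. x \<in> X"
    using AE_not_in[OF N] AE_space by eventually_elim (auto simp: X_def)
  have XT: "T n x \<in> X" if "x \<in> X" for n x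
  proof -
    have "T k (T n x) = T (k + n) x" for k using good[of x] that by (auto simp: X_def)
    then show ?thesis using that sp by (auto simp: X_def)
  qed
  define T' where "T' n x = (if x \<in> X then T n x else x)" for n x
  have T'T: "AE x in M. T' n x = T n x" for n
    using AEX by eventually_elim (simp add: T'_def)
  have T'm [measurable]: "T' n \<in> M \<rightarrow>\<^sub>M M" for n
    unfolding T'_def by measurable
  have "pmp_action M T'"
  proof (intro pmp_action.intro pmp_action_axioms.intro)
    show "distr M M (T' n) = M" for n
      by (subst distr_cong_AE[OF refl refl T'T]) (simp_all add: distr)
    show "T' 0 x = x" if "x \<in> space M" for x
      using good[of x] by (auto simp: T'_def X_def)
    show "T' (n + k) x = T' n (T' k x)" if "x \<in> space M" for n k x
      using good[of x] XT[of x k] by (auto simp: T'_def X_def)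
    show "ergodic_action M T'"
      unfolding ergodic_action_def
    proof (intro ballI impI)
      fix A assume A: "A \<in> sets M" "\<forall>n. AE x in M. T' n x \<in> A \<longleftrightarrow> x \<in> A"
      have "AE x in M. T n x \<in> A \<longleftrightarrow> x \<in> A" for n
        using T'T[of n] spec[OF A(2), of n] by eventually_elim simp
      then show "A \<in> null_sets M \<or> space M - A \<in> null_sets M"
        using assms(3) A(1) unfolding ergodic_action_def by blast
    qed
  qed (use assms(1) in simp_all)
  then show thesis using T'T by (rule that)
qed

text \<open>For each \<open>n\<close> the two skew products agree off a product of a null set with
  the fibre, so they have the same almost invariant sets.\<close>

lemma ergodic_skew_product_cong:
  assumes "sigma_finite_measure \<mu>" and "ergodic_action (M \<Otimes>\<^sub>M \<mu>) (skew_product T' F)" and eq: "\<And>n. AE x in M. T' n x = T n x"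
  shows "ergodic_action (M \<Otimes>\<^sub>M \<mu>) (skew_product T F)"
  unfolding ergodic_action_def
proof (intro ballI impI)
  fix E assume E: "E \<in> sets (M \<Otimes>\<^sub>M \<mu>)"
    and inv: "\<forall>n. AE p in M \<Otimes>\<^sub>M \<mu>. skew_product T F n p \<in> E \<longleftrightarrow> p \<in> E"
  have "AE p in M \<Otimes>\<^sub>M \<mu>. skew_product T' F n p \<in> E \<longleftrightarrow> p \<in> E" for n
  proof -
    obtain N where N: "N \<in> null_sets M" "{x \<in> space M. T' n x \<noteq> T n x} \<subseteq> N"
      using eq[of n] by (auto simp: eventually_ae_filter)
    have "AE p in M \<Otimes>\<^sub>M \<mu>. fst p \<notin> N"
    proof (rule AE_I')
      show "N \<times> space \<mu> \<in> null_sets (M \<Otimes>\<^sub>M \<mu>)"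
        using N(1) by (intro sigma_finite_measure.times_in_null_sets1 assms(1)) auto
    qed (auto simp: space_pair_measure)
    then show ?thesis
      using spec[OF inv, of n] AE_space
      by eventually_elim (use N(2) in \<open>auto simp: skew_product_def space_pair_measure split: prod.splits\<close>)
  qed
  then show "E \<in> null_sets (M \<Otimes>\<^sub>M \<mu>) \<or> space (M \<Otimes>\<^sub>M \<mu>) - E \<in> null_sets (M \<Otimes>\<^sub>M \<mu>)"
    using assms(2) E unfolding ergodic_action_def by blast
qed

section \<open>Integer vectors: generators and Folner cubes\<close>

lemma vec_in_group_closure_axis:
  "(v :: int ^ 'd) \<in> group_closure (range (\<lambda>k. axis k 1))"
proof -
  let ?C = "group_closure (range (\<lambda>k::'d. axis k (1::int)))"
  have nat: "axis k (int m) \<in> ?C" for k m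
  proof (induction m)
    case 0
    have "axis k (int 0) = (0 :: int ^ 'd)" by (simp add: vec_eq_iff axis_def)
    then show ?case by (simp only: zero_in_group_closure)
  next
    case (Suc m)
    have "axis k (int (Suc m)) = axis k (int m) + (axis k 1 :: int ^ 'd)"
      by (simp add: vec_eq_iff axis_def)
    then show ?case
      by (simp only:) (rule group_closure_add[OF Suc group_closure.base], simp)
  qed
  have int: "axis k m \<in> ?C" for k m
  proof (cases m rule: int_cases2)
    case (nonpos n)
    then have "axis k m = - (axis k (int n) :: int ^ 'd)" by (simp add: vec_eq_iff axis_def)
    then show ?thesis using nat by simp
  qed (use nat in simp)
  have sum: "(\<Sum>k\<in>I. axis k (v $ k)) \<in> ?C" if "finite I" for I
    using that by induction (auto intro!: group_closure_add int)
  have "v = (\<Sum>k\<in>UNIV. axis k (v $ k))"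
    by (simp add: vec_eq_iff axis_def sum.delta)
  then show ?thesis using sum[of UNIV] by simp
qed

lemma finite_box_int: "finite {v :: int ^ 'd. \<forall>i. a \<le> v $ i \<and> v $ i < b}"
  and card_box_int: "card {v :: int ^ 'd. \<forall>i. a \<le> v $ i \<and> v $ i < b} = nat (b - a) ^ CARD('d)"
proof -
  have "bij_betw (\<lambda>f. \<chi> i. f i) (PiE UNIV (\<lambda>_::'d. {a..<b})) {v :: int ^ 'd. \<forall>i. a \<le> v $ i \<and> v $ i < b}"
    by (rule bij_betwI[where g = "\<lambda>v. ($) v"]) (auto simp: PiE_def Pi_def)
  note bij = this
  show "card {v :: int ^ 'd. \<forall>i. a \<le> v $ i \<and> v $ i < b} = nat (b - a) ^ CARD('d)"
    using bij_betw_same_card[OF bij] by (simp add: card_PiE)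
  show "finite {v :: int ^ 'd. \<forall>i. a \<le> v $ i \<and> v $ i < b}"
    using bij_betw_finite[OF bij] by (simp add: finite_PiE)
qed

text \<open>If \<open>m\<close> bounds all coordinates of \<open>K\<close>, a cube of side
  \<open>N\<close> and its translate by \<open>k \<in> K\<close> share a cube of side
  \<open>N - 2 * m\<close>. The symmetric difference has at most
  \<open>2 * (N ^ D - (N - 2 * m) ^ D)\<close> points, a vanishing fraction of
  \<open>N ^ D\<close>.\<close>

lemma folner_int_vec:
  fixes K :: "(int ^ 'd) set"
  assumes K: "finite K" and \<kappa>: "\<kappa> > 0"
  shows "\<exists>\<Phi>. finite \<Phi> \<and> \<Phi> \<noteq> {} \<and>
    (\<forall>k\<in>K. real (card (sym_diff \<Phi> ((+) k ` \<Phi>))) \<le> \<kappa> * real (card \<Phi>))"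
proof -
  define m where "m = (\<Sum>k\<in>K. \<Sum>i\<in>UNIV. nat \<bar>k $ i\<bar>)"
  have km: "\<bar>k $ i\<bar> \<le> int m" if "k \<in> K" for k i
  proof -
    have "nat \<bar>k $ i\<bar> \<le> (\<Sum>i\<in>UNIV. nat \<bar>k $ i\<bar>)" by (rule member_le_sum) auto
    also have "\<dots> \<le> m" unfolding m_def using that K by (intro member_le_sum) auto
    finally show ?thesis by linarith
  qed
  define D where "D = CARD('d)"
  have "(\<lambda>N. 2 * (1 - (1 - real (2 * m) * (1 / real N)) ^ D)) \<longlonglongrightarrow> 2 * (1 - (1 - real (2 * m) * 0) ^ D)"
    by (intro tendsto_intros lim_1_over_n)
  then have "eventually (\<lambda>N. 2 * (1 - (1 - real (2 * m) * (1 / real N)) ^ D) < \<kappa>) sequentially"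
    using \<kappa> by (intro order_tendstoD(2)) auto
  \<comment> \<open>This makes the natural number subtraction \<open>N - 2 * m\<close> exact and the
    cube nonempty.\<close>
  moreover have "eventually (\<lambda>N. 2 * m + 1 \<le> N) sequentially"
    by (rule eventually_ge_at_top)
  ultimately have "eventually (\<lambda>N. 2 * (1 - (1 - real (2 * m) * (1 / real N)) ^ D) < \<kappa> \<and> 2 * m + 1 \<le> N) sequentially"
    by eventually_elim simp
  then obtain N where N: "2 * (1 - (1 - real (2 * m) * (1 / real N)) ^ D) < \<kappa>" "2 * m + 1 \<le> N"
    by (auto dest: eventually_happens)
  define \<Phi> where "\<Phi> = {v :: int ^ 'd. \<forall>i. 0 \<le> v $ i \<and> v $ i < int N}"
  have fin: "finite \<Phi>" unfolding \<Phi>_def by (rule finite_box_int)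
  have card: "card \<Phi> = N ^ D" unfolding \<Phi>_def card_box_int D_def by simp
  have ne: "\<Phi> \<noteq> {}" using card N(2) by (auto simp: fin)
  have "real (card (sym_diff \<Phi> ((+) k ` \<Phi>))) \<le> \<kappa> * real (card \<Phi>)" if k: "k \<in> K" for k
  proof -
    have "{v :: int ^ 'd. \<forall>i. int m \<le> v $ i \<and> v $ i < int N - int m} \<subseteq> \<Phi> \<inter> (+) k ` \<Phi>"
    proof
      fix v :: "int ^ 'd" assume "v \<in> {v. \<forall>i. int m \<le> v $ i \<and> v $ i < int N - int m}"
      then have v: "int m \<le> v $ i" "v $ i < int N - int m" for i by auto
      have "0 \<le> v $ i \<and> v $ i < int N" "0 \<le> (v - k) $ i \<and> (v - k) $ i < int N" for i
        using v[of i] km[OF k, of i] by auto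
      then have "v \<in> \<Phi>" "v - k \<in> \<Phi>" by (auto simp: \<Phi>_def)
      then show "v \<in> \<Phi> \<inter> (+) k ` \<Phi>" by (auto intro!: image_eqI[of _ _ "v - k"])
    qed
    then have "card {v :: int ^ 'd. \<forall>i. int m \<le> v $ i \<and> v $ i < int N - int m} \<le> card (\<Phi> \<inter> (+) k ` \<Phi>)"
      using fin by (intro card_mono) auto
    moreover have "nat (int N - int m - int m) = N - 2 * m" by simp
    ultimately have I: "(N - 2 * m) ^ D \<le> card (\<Phi> \<inter> (+) k ` \<Phi>)"
      unfolding card_box_int D_def by simp
    have "card (sym_diff \<Phi> ((+) k ` \<Phi>)) = card (\<Phi> - (+) k ` \<Phi>) + card ((+) k ` \<Phi> - \<Phi>)"
      using fin by (intro card_Un_disjoint) auto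
    moreover have "card (\<Phi> - (+) k ` \<Phi>) = N ^ D - card (\<Phi> \<inter> (+) k ` \<Phi>)"
      using fin card by (simp add: card_Diff_subset_Int)
    moreover have "card ((+) k ` \<Phi> - \<Phi>) = N ^ D - card (\<Phi> \<inter> (+) k ` \<Phi>)"
      using fin card by (simp add: card_Diff_subset_Int card_image Int_commute)
    ultimately have "real (card (sym_diff \<Phi> ((+) k ` \<Phi>))) \<le> 2 * (real (N ^ D) - real ((N - 2 * m) ^ D))"
      using I card_mono[of \<Phi> "\<Phi> \<inter> (+) k ` \<Phi>"] fin card by simp
    also have "\<dots> = 2 * (1 - (1 - real (2 * m) * (1 / real N)) ^ D) * real N ^ D"
    proof -
      have "real (N - 2 * m) = (1 - real (2 * m) * (1 / real N)) * real N"
        using N(2) by (simp add: field_simps)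
      then have "real ((N - 2 * m) ^ D) = (1 - real (2 * m) * (1 / real N)) ^ D * real N ^ D"
        by (simp only: of_nat_power power_mult_distrib)
      then show ?thesis by (simp only: of_nat_power) (simp add: left_diff_distrib)
    qed
    also have "\<dots> \<le> \<kappa> * real N ^ D" using N(1) by (intro mult_right_mono) auto
    finally show ?thesis by (simp add: card)
  qed
  then show ?thesis using fin ne by blast
qed

theorem theorem2:
  fixes M :: "'a measure"
    and T :: "int ^ 'd \<Rightarrow> 'a \<Rightarrow> 'a"
    and G S :: "(real ^ 'D) set"
    and mG :: "(real ^ 'D) measure"
  assumes "closed G" and "additive_subgroup G" and "span G = UNIV"
    and "haar_measure_on G mG"
    and "finite S" and "S \<subseteq> G" and "uminus ` S = S" and "closure (group_closure S) = G"
    and "prob_space M" and "standard_borel_measure M" and "non_atomic M"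
    and "mp_action M T" and "ergodic_action M T"
  shows "\<exists>F :: int ^ 'd \<Rightarrow> 'a \<Rightarrow> real ^ 'D.
           cocycle M T G F \<and> bounded_cocycle M F \<and>
           ergodic_action (M \<Otimes>\<^sub>M mG) (skew_product T F) \<and>
           (\<forall>k::'d. \<forall>x\<in>space M. F (axis k 1) x \<in> S \<union> {0})"
proof -
  \<comment> \<open>The cocycle is built for \<open>T'\<close>, whose action laws hold everywhere,
    and then serves \<open>T\<close> too, since the cocycle identity and ergodicity ignore null
    sets.\<close>
  obtain T' :: "int ^ 'd \<Rightarrow> 'a \<Rightarrow> 'a" where T': "pmp_action M T'" and eq: "\<And>n. AE x in M. T' n x = T n x"
    by (rule mp_action_pmp_action[OF \<open>prob_space M\<close> \<open>mp_action M T\<close> \<open>ergodic_action M T\<close>]) (rule that)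
  interpret pmp_action M T' by (rule T')
  interpret generated_action M T' "range (\<lambda>k. axis k 1)"
    by unfold_locales (use \<open>non_atomic M\<close> folner_int_vec in auto)
  obtain b :: "nat \<Rightarrow> 'a set" where b: "\<And>i. b i \<in> sets M" "sets M = sigma_sets (space M) (range b)"
    by (rule standard_borel_countably_generated[OF \<open>standard_borel_measure M\<close>]) (rule that)
  have sym: "- s \<in> S" if "s \<in> S" for s
    using \<open>uminus ` S = S\<close> that by (metis imageI)
  have gen: "group_closure (range (\<lambda>k::'d. axis k (1::int))) = UNIV"
    using vec_in_group_closure_axis by auto
  \<comment> \<open>The steps come from \<open>insert 0 S\<close>; 0 is the increment along a
    generator that leaves the level unchanged.\<close>
  obtain F where Fm: "\<And>n. F n \<in> borel_measurable M" and fin: "\<And>n. finite (F n ` space M)"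
    and F\<Lambda>: "\<And>n. F n ` space M \<subseteq> group_closure (insert 0 S)"
    and Fe: "\<And>n x. n \<in> range (\<lambda>k::'d. axis k 1) \<Longrightarrow> x \<in> space M \<Longrightarrow> F n x \<in> insert 0 S"
    and cocycle: "\<And>n k. AE x in M. F (n + k) x = F k x + F n (T' k x)"
    and essential: "\<And>A v. A \<in> sets M \<Longrightarrow> 0 < measure M A \<Longrightarrow> v \<in> insert 0 S \<Longrightarrow>
       \<exists>g. 0 < measure M {x \<in> space M. x \<in> A \<and> T' g x \<in> A \<and> F g x = v}"
    by (rule essential_cocycle[of "insert 0 S" b]) (use \<open>finite S\<close> sym gen b in auto)
  have FG: "F n x \<in> G" if "x \<in> space M" for n x
    using F\<Lambda>[of n] that closure_subset[of "group_closure S"] \<open>closure (group_closure S) = G\<close> by auto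
  have haar: "haar_space G mG"
    using assms by unfold_locales
  then have "ergodic_action (M \<Otimes>\<^sub>M mG) (skew_product T' F)"
    using T' Fm FG \<open>finite S\<close> sym \<open>closure (group_closure S) = G\<close> essential
    by (intro ergodic_skew_product) auto
  then have "ergodic_action (M \<Otimes>\<^sub>M mG) (skew_product T F)"
    using eq by (rule ergodic_skew_product_cong[OF haar_space.sigma_finite_haar[OF haar]])
  moreover have "cocycle M T G F"
    unfolding cocycle_def
  proof (intro conjI allI)
    show "F n \<in> M \<rightarrow>\<^sub>M restrict_space borel G" for n
      using Fm FG by (intro measurable_restrict_space2) auto
    show "AE x in M. F (n + k) x = F k x + F n (T k x)" for n k
      using cocycle[of n k] eq[of k] by eventually_elim simp
  qed
  moreover have "bounded_cocycle M F"
    using fin by (simp add: bounded_cocycle_def finite_imp_bounded)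
  moreover have "F (axis k 1) x \<in> S \<union> {0}" if "x \<in> space M" for k x
    using Fe[OF rangeI that, of k] by simp
  ultimately show ?thesis by blast
qed

end
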